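(* For a chordal graph $G$, the following are equivalent: (i) $G$ is a special tree; (ii) $G$ is strongly critical; (iii) $G$ is critical.
   Context: All graphs are finite and simple. A vertex cover of $G$ is a set $C \subseteq V(G)$ meeting every edge; $\tau(G)$ is the minimum size of a vertex cover. A connected vertex cover of $G$ is a vertex cover $C$ such that $G[C]$ is connected (if $G$ is disconnected, $G[C]$ must have the same number of connected components as $G$); $\tau_c(G)$ is its minimum size. The price of connectivity of a graph $G$ with at least one edge is $\mathrm{PoC}(G) = \tau_c(G)/\tau(G)$. A graph $G$ is critical if the price of connectivity of every proper induced subgraph of $G$ is strictly smaller than that of $G$; it is strongly critical if the price of connectivity of every proper (not necessarily induced) subgraph of $G$ is strictly smaller than that of $G$. A tree $T$ is special if it is obtained from some tree by subdividing each edge exactly once and then attaching one new pendant vertex to every leaf of the resulting tree.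
   Formalization: Isolated vertices are not counted as components when a disconnected graph's connected vertex covers are defined (else the special tree P5 is not critical), and the vertex of the one-vertex tree counts as a leaf, so the single edge K2 is a special tree. *)

theory Defs
  imports Complex_Main "Graph_Theory.Graph_Theory"
begin

text \<open>A finite simple graph is a \<^locale>\<open>pair_graph\<close>: an undirected edge between u and v is
  the pair of arcs (u,v), (v,u). In such symmetric digraphs the strongly connected components are
  the connected components.\<close>

section \<open>Vertex covers and the price of connectivity\<close>

definition vertex_cover :: "'a pair_pre_digraph \<Rightarrow> 'a set \<Rightarrow> bool" where
  "vertex_cover G C \<longleftrightarrow> C \<subseteq> pverts G \<and> (\<forall>(u, v) \<in> parcs G. u \<in> C \<or> v \<in> C)"

definition vertex_cover_number :: "'a pair_pre_digraph \<Rightarrow> nat" where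
  "vertex_cover_number G = (LEAST n. \<exists>C. vertex_cover G C \<and> card C = n)"

definition nontrivial_components :: "'a pair_pre_digraph \<Rightarrow> 'a set set" where
  "nontrivial_components G =
     {S \<in> pre_digraph.sccs_verts (with_proj G). \<exists>(u, v) \<in> parcs G. u \<in> S \<and> v \<in> S}"

text \<open>Isolated vertices of the graph G are discarded when its components are counted: otherwise a
  vertex cover of G would be penalised for not containing (or not imitating) isolated vertices, and
  deleting the neighbour of an end of the path on five vertices, which leaves a single vertex and a
  path on three vertices, would raise the price of connectivity from 3/2 to 2. For graphs without
  isolated vertices the number below is the number of all components.\<close>

lemma nontrivial_components_no_isolated:
  assumes "pair_graph G" and "\<And>v. v \<in> pverts G \<Longrightarrow> \<exists>w. (v, w) \<in> parcs G"
  shows "nontrivial_components G = pre_digraph.sccs_verts (with_proj G)"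
proof -
  interpret pair_graph G by fact
  have "\<exists>(u, v) \<in> parcs G. u \<in> S \<and> v \<in> S" if S: "S \<in> sccs_verts" for S
  proof -
    obtain u where u: "u \<in> S" using S by (auto simp: sccs_verts_def)
    then have "u \<rightarrow>\<^sup>*\<^bsub>with_proj G\<^esub> u" using S by (auto simp: sccs_verts_def)
    then have "u \<in> pverts G" using reachable_in_verts(1) by auto
    then obtain w where w: "(u, w) \<in> parcs G" using assms(2) by blast
    then have "(w, u) \<in> parcs G" using graph_symmetric by auto
    then have "u \<rightarrow>\<^sup>*\<^bsub>with_proj G\<^esub> w" "w \<rightarrow>\<^sup>*\<^bsub>with_proj G\<^esub> u" using w by auto
    then have "w \<in> S" using S u unfolding sccs_verts_def by blast
    then show ?thesis using u w by blast
  qed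
  then show ?thesis by (auto simp: nontrivial_components_def)
qed

definition connected_vertex_cover :: "'a pair_pre_digraph \<Rightarrow> 'a set \<Rightarrow> bool" where
  "connected_vertex_cover G C \<longleftrightarrow> vertex_cover G C \<and>
     (if Digraph_Component.connected (with_proj G)
      then Digraph_Component.connected (with_proj G \<restriction> C)
      else card (pre_digraph.sccs_verts (with_proj G \<restriction> C)) = card (nontrivial_components G))"

definition connected_vertex_cover_number :: "'a pair_pre_digraph \<Rightarrow> nat" where
  "connected_vertex_cover_number G = (LEAST n. \<exists>C. connected_vertex_cover G C \<and> card C = n)"

text \<open>Only meaningful if G has an edge; \<open>critical\<close> and \<open>strongly_critical\<close> below therefore require
  an edge and compare only with subgraphs that have an edge.\<close>

definition PoC :: "'a pair_pre_digraph \<Rightarrow> real" where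
  "PoC G = real (connected_vertex_cover_number G) / real (vertex_cover_number G)"

definition critical :: "'a pair_pre_digraph \<Rightarrow> bool" where
  "critical G \<longleftrightarrow> parcs G \<noteq> {} \<and>
     (\<forall>H. pair_graph H \<and> induced_subgraph (with_proj H) (with_proj G) \<and> H \<noteq> G \<and> parcs H \<noteq> {}
        \<longrightarrow> PoC H < PoC G)"

definition strongly_critical :: "'a pair_pre_digraph \<Rightarrow> bool" where
  "strongly_critical G \<longleftrightarrow> parcs G \<noteq> {} \<and>
     (\<forall>H. pair_graph H \<and> subgraph (with_proj H) (with_proj G) \<and> H \<noteq> G \<and> parcs H \<noteq> {}
        \<longrightarrow> PoC H < PoC G)"

section \<open>Chordal graphs and special trees\<close>

text \<open>In a symmetric digraph, \<^const>\<open>pre_digraph.cycle\<close> also holds of the closed walk u, v, u along a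
  single edge; the cycles of the undirected graph are those of length at least 3. For this reason
  the library's notion of a tree is not usable here.\<close>

definition chordal :: "'a pair_pre_digraph \<Rightarrow> bool" where
  "chordal G \<longleftrightarrow> (\<forall>p. pre_digraph.cycle (with_proj G) p \<and> length p \<ge> 4 \<longrightarrow>
     (\<exists>(x, y) \<in> parcs G. x \<in> fst ` set p \<and> y \<in> fst ` set p \<and> (x, y) \<notin> set p \<and> (y, x) \<notin> set p))"

definition undirected_tree :: "'a pair_pre_digraph \<Rightarrow> bool" where
  "undirected_tree T \<longleftrightarrow> pair_graph T \<and> Digraph_Component.connected (with_proj T) \<and>
     (\<forall>p. pre_digraph.cycle (with_proj T) p \<longrightarrow> length p < 3)"

text \<open>\<open>Inl v\<close> is the old vertex v, \<open>Inr {u, v}\<close> the vertex subdividing the edge uv.\<close>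

definition subdivide_edges :: "'a pair_pre_digraph \<Rightarrow> ('a + 'a set) pair_pre_digraph" where
  "subdivide_edges G =
     \<lparr>pverts = Inl ` pverts G \<union> (\<lambda>(u, v). Inr {u, v}) ` parcs G,
      parcs = (\<Union>(u, v) \<in> parcs G. {(Inl u, Inr {u, v}), (Inr {u, v}, Inl u)})\<rparr>"

text \<open>The vertex of the one-vertex tree counts as a leaf, so that the special tree obtained from the
  one-vertex tree is the single edge. The latter is critical, as it has no proper subgraph with an
  edge.\<close>

definition leaves :: "'a pair_pre_digraph \<Rightarrow> 'a set" where
  "leaves G = {v \<in> pverts G. out_degree (with_proj G) v \<le> 1}"

text \<open>\<open>Inr v\<close> is the new pendant vertex attached to the leaf v.\<close>

definition attach_pendants :: "'a pair_pre_digraph \<Rightarrow> ('a + 'a) pair_pre_digraph" where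
  "attach_pendants G =
     \<lparr>pverts = Inl ` pverts G \<union> Inr ` leaves G,
      parcs = (\<lambda>(u, v). (Inl u, Inl v)) ` parcs G \<union>
              (\<Union>v \<in> leaves G. {(Inl v, Inr v), (Inr v, Inl v)})\<rparr>"

text \<open>Taking T on the vertex type of G is no restriction, since T is smaller than G.\<close>

definition special_tree :: "'a pair_pre_digraph \<Rightarrow> bool" where
  "special_tree G \<longleftrightarrow> (\<exists>T :: 'a pair_pre_digraph. undirected_tree T \<and>
     digraph_iso (with_proj (attach_pendants (subdivide_edges T))) (with_proj G))"

end

theory Submission
  imports Defs
begin

text \<open>Write \<open>S\<close> for the set of cut vertices. In a connected chordal graph with at least two vertices, a nonempty
  vertex cover is connected iff it contains \<open>S\<close>, since two neighbours of a non-cut vertex \<open>i\<close> are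
  joined by a path inside the neighbourhood of \<open>i\<close>.

  Let \<open>G\<close> be critical and chordal, hence connected, and not a single edge. Deleting a non-cut vertex
  costs a connected cover at most one vertex, so no minimum cover \<open>X\<close> contains a non-cut vertex;
  thus \<open>X \<subseteq> S\<close> and \<open>S\<close> is a minimum connected cover. The vertices outside \<open>S\<close> are pendant. Cutting
  \<open>G\<close> at a cut vertex into two induced subgraphs, one of them retaining a pendant vertex at the cut
  where needed, gives two subgraphs whose ratios have a mediant at least that of \<open>G\<close>; this excludes
  edges inside \<open>X\<close> and vertices of degree at least 3 in \<open>Y = S - X\<close>. So \<open>G\<close> is bipartite, a tree, and
  the vertices of \<open>Y\<close> subdivide the edges of a tree on \<open>X\<close>.

  Conversely, a special tree over a tree with \<open>n\<close> vertices has ratio at least \<open>2 - 1/n\<close>. Since a connected graph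
  satisfies \<open>\<tau>\<^sub>c \<le> 2\<tau> - 1\<close>, a subgraph \<open>H\<close> can only match this if it has a single nontrivial component
  and \<open>\<tau>(H) = n\<close>. In that case its vertices of degree at least 2 form a connected cover, which is too
  small unless \<open>H = G\<close>.\<close>

section \<open>Connectivity, vertex covers and cut vertices\<close>

text \<open>A single arc relation \<open>E\<close> is kept fixed and only vertex sets vary, so
  induced subgraphs are mere subsets. Both directions meet in the locale
  \<open>special_structure\<close>: a partition into old, subdividing and pendant vertices with
  local axioms, where the absence of cycles is hidden in the axiom that a subdividing vertex
  separates its two neighbours.

  Cut vertices bound \<open>tauc\<close> from below in any connected graph with at least two
  vertices; chordality supplies the matching upper bound and, once the graph is bipartite, the
  absence of cycles. Cutting at a vertex is delicate: every old cut vertex must remain one in the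
  piece that counts it, while the traces of \<open>X\<close> must cover both pieces without counting
  a vertex twice. The side conditions of \<open>no_split\<close> reconcile the two demands.

  The value 2 - 1/n comes from |X| = n, |Y| \<ge> n - 1, \<open>tauc\<close> \<ge> |X| + |Y| and
  \<open>tau\<close> \<le> |X|. A subgraph needs only an upper bound on its connected cover number,
  so its nontrivial components can be summed: k components turn 2t - 1 into 2t - k, which is extra
  slack.\<close>

definition conn :: "('a \<times> 'a) set \<Rightarrow> 'a set \<Rightarrow> bool" where
  "conn E U \<longleftrightarrow> U \<noteq> {} \<and> (\<forall>u\<in>U. \<forall>v\<in>U. (u, v) \<in> rtrancl_on U E)"

definition covers :: "('a \<times> 'a) set \<Rightarrow> 'a set \<Rightarrow> 'a set \<Rightarrow> bool" where
  "covers E U C \<longleftrightarrow> C \<subseteq> U \<and> (\<forall>u\<in>U. \<forall>v\<in>U. (u, v) \<in> E \<longrightarrow> u \<in> C \<or> v \<in> C)"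

text \<open>The empty set is not connected, so the vertex of a one-vertex graph counts as a cut
  vertex. This is why singletons are excluded again and again below.\<close>

definition cuts :: "('a \<times> 'a) set \<Rightarrow> 'a set \<Rightarrow> 'a set" where
  "cuts E U = {s \<in> U. \<not> conn E (U - {s})}"

text \<open>The only consequence of chordality used below; quantifying over \<open>U\<close> makes it hereditary.\<close>

definition links_connected :: "('a \<times> 'a) set \<Rightarrow> bool" where
  "links_connected E \<longleftrightarrow> (\<forall>U c w w'. c \<notin> U \<longrightarrow> (c, w) \<in> E \<longrightarrow> (c, w') \<in> E \<longrightarrow>
     (w, w') \<in> rtrancl_on U E \<longrightarrow> (w, w') \<in> rtrancl_on (U \<inter> E `` {c}) E)"

lemma rtrancl_on_subset: "U \<subseteq> W \<Longrightarrow> (u, v) \<in> rtrancl_on U E \<Longrightarrow> (u, v) \<in> rtrancl_on W E"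
  by (rule rtrancl_on_mono[OF subset_refl])

lemma rtrancl_on_edge: "(u, v) \<in> E \<Longrightarrow> u \<in> U \<Longrightarrow> v \<in> U \<Longrightarrow> (u, v) \<in> rtrancl_on U E"
  by (rule rtrancl_on_into_rtrancl_on[OF rtrancl_on_refl])

lemma conn_edge_out:
  assumes "conn E U" "W \<subseteq> U" "W \<noteq> {}" "W \<noteq> U"
  obtains w z where "w \<in> W" "z \<in> U" "z \<notin> W" "(w, z) \<in> E"
proof -
  obtain a b where ab: "a \<in> W" "b \<in> U" "b \<notin> W" using assms(2-4) by blast
  then have "(a, b) \<in> rtrancl_on U E" using assms(1,2) by (auto simp: conn_def)
  then have "b \<in> W \<or> (\<exists>w z. w \<in> W \<and> z \<in> U \<and> z \<notin> W \<and> (w, z) \<in> E)"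
    by (induct rule: rtrancl_on_induct) (use ab(1) in blast)+
  then show thesis using that ab(3) by blast
qed

lemma conn_neighbour:
  assumes "conn E U" "s \<in> U" "U \<noteq> {s}"
  obtains v where "v \<in> U" "v \<noteq> s" "(s, v) \<in> E"
  using conn_edge_out[OF assms(1), of "{s}"] assms(2,3) by blast

locale sgraph =
  fixes E :: "('a \<times> 'a) set"
  assumes sym: "(u, v) \<in> E \<Longrightarrow> (v, u) \<in> E"
    and irr: "(u, u) \<notin> E"
begin

abbreviation rch :: "'a set \<Rightarrow> ('a \<times> 'a) set" where "rch U \<equiv> rtrancl_on U E"

lemma rch_sym: "(u, v) \<in> rch U \<Longrightarrow> (v, u) \<in> rch U"
  using rtrancl_on_sym[of E U] sym by (blast intro: symI dest: symD)

lemma conn_rchI: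
  assumes "c \<in> U" "\<And>v. v \<in> U \<Longrightarrow> (c, v) \<in> rch U"
  shows "conn E U"
  unfolding conn_def using assms(1) rtrancl_on_trans[OF rch_sym[OF assms(2)] assms(2)] by auto

lemma conn_insert:
  assumes "conn E U" "u \<in> U" "(u, c) \<in> E"
  shows "conn E (insert c U)"
proof (rule conn_rchI[of u])
  fix v assume v: "v \<in> insert c U"
  show "(u, v) \<in> rch (insert c U)"
  proof (cases "v \<in> U")
    case True
    then have "(u, v) \<in> rch U" using assms by (auto simp: conn_def)
    then show ?thesis by (rule rtrancl_on_subset[rotated]) auto
  next
    case False
    then show ?thesis using v assms by (auto intro: rtrancl_on_edge)
  qed
qed (use assms in auto)

text \<open>A walk from \<open>c\<close> that enters \<open>R\<close> can leave it only at
  \<open>c\<close>, so the excursion can be skipped.\<close>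

lemma conn_Diff:
  assumes "conn E V" "c \<in> V" "c \<notin> R" "\<And>r v. r \<in> R \<Longrightarrow> v \<in> V \<Longrightarrow> (r, v) \<in> E \<Longrightarrow> v \<in> insert c R"
  shows "conn E (V - R)"
proof (rule conn_rchI[of c])
  fix v assume v: "v \<in> V - R"
  then have "(c, v) \<in> rch V" using assms by (auto simp: conn_def)
  then have "v \<notin> R \<longrightarrow> (c, v) \<in> rch (V - R)"
  proof (induct rule: rtrancl_on_induct)
    case base
    then show ?case using assms by auto
  next
    case (step y z)
    show ?case
    proof (cases "y \<in> R")
      case True
      then show ?thesis using assms(2-4) step by blast
    next
      case False
      then show ?thesis using step by (auto intro: rtrancl_on_into_rtrancl_on)
    qed
  qed
  then show "(c, v) \<in> rch (V - R)" using v by auto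
qed (use assms in auto)

lemma cutsE:
  assumes "s \<in> cuts E V" "c \<in> V" "c \<noteq> s"
  obtains q where "q \<in> V" "q \<noteq> s" "(c, q) \<notin> rch (V - {s})"
  using assms conn_rchI[of c "V - {s}"] unfolding cuts_def by auto

lemma cutsI: "s \<in> V \<Longrightarrow> a \<in> V \<Longrightarrow> b \<in> V \<Longrightarrow> a \<noteq> s \<Longrightarrow> b \<noteq> s \<Longrightarrow> (a, b) \<notin> rch (V - {s}) \<Longrightarrow> s \<in> cuts E V"
  unfolding cuts_def conn_def by auto

text \<open>A vertex with a single neighbour could be deleted by \<open>conn_Diff\<close>, with that
  neighbour as attachment point.\<close>

lemma cuts_two_neighbours:
  assumes "conn E V" "s \<in> cuts E V" "V \<noteq> {s}"
  obtains a b where "a \<in> V" "b \<in> V" "(s, a) \<in> E" "(s, b) \<in> E" "a \<noteq> b"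
proof -
  have s: "s \<in> V" using assms by (auto simp: cuts_def)
  obtain a where a: "a \<in> V" "a \<noteq> s" "(s, a) \<in> E" using conn_neighbour[OF assms(1) s assms(3)] .
  have "\<not> conn E (V - {s})" using assms(2) by (auto simp: cuts_def)
  then have "\<not> (\<forall>v\<in>V. (s, v) \<in> E \<longrightarrow> v = a)" using conn_Diff[OF assms(1), of a "{s}"] a by auto
  then show thesis using that a by blast
qed

text \<open>If \<open>s\<close> were missing, every vertex other than \<open>s\<close> would lie in
  \<open>C\<close> or be adjacent to it, because the complement of a cover is independent. Then
  \<open>C\<close> would hold \<open>U - {s}\<close> together.\<close>

lemma cuts_subset_connected_cover:
  assumes "conn E U" "covers E U C" "conn E C" "s \<in> cuts E U" "U \<noteq> {s}"
  shows "s \<in> C"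
proof (rule ccontr)
  assume s: "s \<notin> C"
  have sU: "s \<in> U" using assms by (auto simp: cuts_def)
  have C: "C \<subseteq> U - {s}" using assms(2) s by (auto simp: covers_def)
  obtain c where c: "c \<in> C" using assms(3) by (auto simp: conn_def)
  have CC: "(c, v) \<in> rch (U - {s})" if "v \<in> C" for v
    using assms(3) c that rtrancl_on_subset[OF C] by (auto simp: conn_def)
  have "conn E (U - {s})"
  proof (rule conn_rchI[of c])
    fix u assume u: "u \<in> U - {s}"
    show "(c, u) \<in> rch (U - {s})"
    proof (cases "u \<in> C")
      case False
      obtain v where v: "v \<in> U" "(u, v) \<in> E"
        using conn_neighbour[OF assms(1), of u] u sU by auto
      then have "v \<in> C" using assms(2) u False by (auto simp: covers_def)
      then show ?thesis using CC[of v] u sym[OF v(2)] by (auto intro: rtrancl_on_into_rtrancl_on)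
    qed (rule CC)
  qed (use c C in auto)
  then show False using assms(4) by (auto simp: cuts_def)
qed

text \<open>Let \<open>A\<close> be a component of the cover and \<open>T\<close> the set
  \<open>A\<close> with its neighbours outside the cover. An edge leaving \<open>T\<close> would
  start at some \<open>t\<close> outside \<open>C\<close>. As \<open>t\<close> is no cut vertex, its
  neighbours are joined in \<open>U - {t}\<close>, hence inside the neighbourhood of
  \<open>t\<close>, which lies in \<open>C\<close>; so they all belong to \<open>A\<close>.\<close>

lemma chordal_cover_connected:
  assumes links: "links_connected E"
    and U: "conn E U" and C: "covers E U C" "cuts E U \<subseteq> C" "C \<noteq> {}"
  shows "conn E C"
proof -
  obtain c where c: "c \<in> C" using C by auto
  define A where "A = {w. (c, w) \<in> rch C}"
  define T where "T = A \<union> {i \<in> U - C. \<exists>a\<in>A. (i, a) \<in> E}"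
  have CU: "C \<subseteq> U" using C by (auto simp: covers_def)
  have AC: "A \<subseteq> C" by (auto simp: A_def dest: in_rtrancl_on_in_F)
  have step: "z \<in> A" if "a \<in> A" "(a, z) \<in> rch C" for a z
    using that rtrancl_on_trans by (fastforce simp: A_def)
  have "T = U"
  proof (rule ccontr)
    assume "T \<noteq> U"
    moreover have "T \<subseteq> U" using AC CU by (auto simp: T_def)
    moreover have "c \<in> T" using c by (auto simp: T_def A_def)
    ultimately obtain t z where tz: "t \<in> T" "z \<in> U" "z \<notin> T" "(t, z) \<in> E"
      using conn_edge_out[OF U, of T] by blast
    show False
    proof (cases "t \<in> A")
      case True
      then have "z \<in> C" using tz sym by (auto simp: T_def)
      then have "z \<in> A" using step[OF True] True AC tz by (auto intro: rtrancl_on_edge)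
      then show False using tz by (auto simp: T_def)
    next
      case False
      then obtain a where a: "a \<in> A" "(t, a) \<in> E" and t: "t \<in> U" "t \<notin> C"
        using tz by (auto simp: T_def)
      have nb: "v \<in> C" if "(t, v) \<in> E" "v \<in> U" for v using C(1) t that by (auto simp: covers_def)
      have "conn E (U - {t})" using C(2) t by (auto simp: cuts_def)
      moreover have "a \<in> U - {t}" "z \<in> U - {t}" using a tz AC CU t irr by auto
      ultimately have "(a, z) \<in> rch (U - {t})" by (auto simp: conn_def)
      then have "(a, z) \<in> rch ((U - {t}) \<inter> E `` {t})"
        using links a tz unfolding links_connected_def by blast
      then have "(a, z) \<in> rch C" by (rule rtrancl_on_subset[rotated]) (use nb in auto)
      then have "z \<in> A" using step a by auto
      then show False using tz by (auto simp: T_def)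
    qed
  qed
  then have "C \<subseteq> A" using CU by (auto simp: T_def)
  then show ?thesis using c by (intro conn_rchI[of c]) (auto simp: A_def)
qed

text \<open>Otherwise \<open>e\<close> could be put back through a neighbour other than
  \<open>s\<close> without disconnecting the rest, and \<open>s\<close> would not cut
  \<open>V\<close>.\<close>

lemma cuts_Diff_noncut:
  assumes "conn E V" "e \<in> V" "V \<noteq> {e}" "s \<in> cuts E V" "s \<noteq> e" "V \<inter> E `` {e} \<noteq> {s}"
  shows "s \<in> cuts E (V - {e})"
proof (rule ccontr)
  assume "s \<notin> cuts E (V - {e})"
  then have c: "conn E (V - {e} - {s})" using assms by (auto simp: cuts_def)
  obtain v where "v \<in> V" "v \<noteq> e" "(e, v) \<in> E" using conn_neighbour[OF assms(1-3)] .
  then obtain v where v: "v \<in> V" "v \<noteq> e" "v \<noteq> s" "(e, v) \<in> E" using assms(6) irr by blast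
  have "conn E (insert e (V - {e} - {s}))" using conn_insert[OF c, of v e] v sym by auto
  moreover have "insert e (V - {e} - {s}) = V - {s}" using assms by auto
  ultimately show False using assms(4) by (auto simp: cuts_def)
qed

end

section \<open>Critical chordal graphs\<close>

definition tau :: "('a \<times> 'a) set \<Rightarrow> 'a set \<Rightarrow> nat" where
  "tau E U = (LEAST n. \<exists>C. covers E U C \<and> card C = n)"

text \<open>This is the connected case only. Disconnected graphs are treated by summing over
  components, so \<open>tauc\<close> is used on connected sets, where a connected cover
  exists.\<close>

definition tauc :: "('a \<times> 'a) set \<Rightarrow> 'a set \<Rightarrow> nat" where
  "tauc E U = (LEAST n. \<exists>C. (covers E U C \<and> conn E C) \<and> card C = n)"

lemma tau_le: "covers E U C \<Longrightarrow> tau E U \<le> card C"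
  unfolding tau_def by (rule Least_le) blast

lemma covers_self: "covers E U U"
  by (auto simp: covers_def)

lemma tau_attained: obtains C where "covers E U C" "card C = tau E U"
proof -
  have "\<exists>C. covers E U C \<and> card C = tau E U"
    unfolding tau_def by (rule LeastI_ex) (use covers_self in blast)
  then show thesis using that by blast
qed

lemma tauc_le: "covers E U C \<Longrightarrow> conn E C \<Longrightarrow> tauc E U \<le> card C"
  unfolding tauc_def by (rule Least_le) blast

lemma tauc_attained:
  assumes "conn E U"
  obtains C where "covers E U C" "conn E C" "card C = tauc E U"
proof -
  have "\<exists>C. (covers E U C \<and> conn E C) \<and> card C = tauc E U"
    unfolding tauc_def by (rule LeastI_ex) (use covers_self assms in blast)
  then show thesis using that by blast
qed

lemma tau_le_tauc: "conn E U \<Longrightarrow> tau E U \<le> tauc E U"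
  by (metis tauc_attained tau_le)

lemma tau_pos:
  assumes "finite U" "u \<in> U" "v \<in> U" "(u, v) \<in> E"
  shows "0 < tau E U"
proof -
  obtain C where C: "covers E U C" "card C = tau E U" by (rule tau_attained)
  then have "C \<noteq> {}" "finite C" using assms by (auto simp: covers_def intro: finite_subset)
  then show ?thesis using C(2) card_gt_0_iff by metis
qed

text \<open>\<open>X\<close> holds the vertices of the underlying tree, \<open>Y\<close> those
  subdividing its edges, \<open>L\<close> the pendant ones. In \<open>X_nb\<close>, a vertex with at
  most one neighbour in \<open>Y\<close> is a leaf of that tree (or its only vertex) and carries
  exactly one pendant vertex.\<close>

locale special_structure = sgraph +
  fixes V X Y L :: "'a set"
  assumes fin: "finite V"
    and conn: "conn E V"
    and V_eq: "V = X \<union> Y \<union> L"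
    and disj: "X \<inter> Y = {}" "X \<inter> L = {}" "Y \<inter> L = {}"
    and edges: "E \<subseteq> X \<times> (Y \<union> L) \<union> (Y \<union> L) \<times> X"
    and Y_nb: "y \<in> Y \<Longrightarrow> \<exists>a b. a \<noteq> b \<and> E `` {y} = {a, b} \<and> (a, b) \<notin> rtrancl_on (V - {y}) E"
    and L_nb: "l \<in> L \<Longrightarrow> \<exists>x. E `` {l} = {x}"
    and X_nb: "x \<in> X \<Longrightarrow> if \<exists>y\<in>Y. \<exists>y'\<in>Y. y \<noteq> y' \<and> (x, y) \<in> E \<and> (x, y') \<in> E
        then E `` {x} \<inter> L = {} else \<exists>l. E `` {x} \<inter> L = {l}"

context sgraph
begin

lemma card_cuts_le_tauc:
  assumes "finite U" "conn E U" "\<And>s. U \<noteq> {s}" "T \<subseteq> cuts E U"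
  shows "card T \<le> tauc E U"
proof -
  obtain C where C: "covers E U C" "conn E C" "card C = tauc E U" using tauc_attained[OF assms(2)] .
  then have "T \<subseteq> C" using cuts_subset_connected_cover assms(2,3,4) by blast
  moreover have "finite C" using C assms by (auto simp: covers_def intro: finite_subset)
  ultimately show ?thesis using C card_mono by metis
qed

lemma conn_reach_set:
  assumes w: "w \<in> U"
  defines "R \<equiv> {v. (w, v) \<in> rch U}"
  shows "R \<subseteq> U" "w \<in> R" "conn E R" "\<And>r v. r \<in> R \<Longrightarrow> v \<in> U \<Longrightarrow> (r, v) \<in> E \<Longrightarrow> v \<in> R"
proof -
  show "R \<subseteq> U" by (auto simp: R_def dest: in_rtrancl_on_in_F)
  show wR: "w \<in> R" using w by (auto simp: R_def)
  show "v \<in> R" if "r \<in> R" "v \<in> U" "(r, v) \<in> E" for r v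
    using that by (auto simp: R_def intro: rtrancl_on_into_rtrancl_on)
  show "conn E R"
  proof (rule conn_rchI[OF wR])
    fix v assume "v \<in> R"
    then have "(w, v) \<in> rch U" by (simp add: R_def)
    then show "(w, v) \<in> rch R"
    proof (induct rule: rtrancl_on_induct)
      case base
      then show ?case using wR by auto
    next
      case (step y z)
      then have "z \<in> R" by (auto simp: R_def intro: rtrancl_on_into_rtrancl_on)
      then show ?case using step by (auto intro: rtrancl_on_into_rtrancl_on)
    qed
  qed
qed

text \<open>In a neighbourhood without edges only trivial paths exist, so
  \<open>links_connected\<close> leaves no path between two neighbours that avoids \<open>c\<close>.
  Thus a bipartite chordal graph has no cycles.\<close>

lemma independent_neighbours_unlinked:
  assumes "links_connected E" "\<And>u v. (c, u) \<in> E \<Longrightarrow> (c, v) \<in> E \<Longrightarrow> (u, v) \<notin> E"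
    and "(c, a) \<in> E" "(c, b) \<in> E" "a \<noteq> b"
  shows "(a, b) \<notin> rch (V - {c})"
proof
  assume "(a, b) \<in> rch (V - {c})"
  then have "(a, b) \<in> rch ((V - {c}) \<inter> E `` {c})"
    using assms(1,3,4) unfolding links_connected_def by blast
  then have "b = a"
    by (induct rule: rtrancl_on_induct) (use assms(2) in auto)
  then show False using assms by simp
qed

end

text \<open>\<open>crit\<close> is the comparison of ratios, multiplied out to stay within the
  natural numbers; a connected set that is no singleton has an edge. The case \<open>a = b\<close>
  of \<open>big\<close> excludes one-vertex graphs.\<close>

locale critical_chordal = sgraph +
  fixes V :: "'a set"
  assumes fin: "finite V" and EV: "E \<subseteq> V \<times> V" and conn: "conn E V"
    and links: "links_connected E"
    and crit: "U \<subset> V \<Longrightarrow> conn E U \<Longrightarrow> \<forall>s. U \<noteq> {s} \<Longrightarrow> tauc E U * tau E V < tauc E V * tau E U"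
    and big: "V \<noteq> {a, b}"
begin

abbreviation "S \<equiv> cuts E V"

lemma S_sub: "S \<subseteq> V" by (auto simp: cuts_def)

lemma V_not_single: "V \<noteq> {s}" using big[of s s] by simp

lemma V_nb:
  assumes "v \<in> V" obtains u where "u \<in> V" "u \<noteq> v" "(v, u) \<in> E"
  using conn_neighbour[OF conn assms V_not_single] .

lemma tau_V_pos: "0 < tau E V"
proof -
  obtain v where v: "v \<in> V" using conn by (auto simp: conn_def)
  then obtain u where "u \<in> V" "(v, u) \<in> E" using V_nb by blast
  then show ?thesis using tau_pos[OF fin v] by blast
qed

lemma noncut:
  assumes "e \<in> V" "e \<notin> S"
  shows "conn E (V - {e})" "tauc E (V - {e}) * tau E V < tauc E V * tau E (V - {e})"
proof -
  show c: "conn E (V - {e})" using assms by (auto simp: cuts_def)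
  show "tauc E (V - {e}) * tau E V < tauc E V * tau E (V - {e})"
    using assms big[of e] by (intro crit c) auto
qed

text \<open>Deleting a non-cut vertex lowers \<open>tauc\<close> by at most one, so criticality prevents it from
  lowering \<open>tau\<close>.\<close>

lemma minimum_cover_subset_cuts:
  assumes X: "covers E V X" "card X = tau E V"
  shows "X \<subseteq> S"
proof (rule ccontr)
  assume "\<not> X \<subseteq> S"
  then obtain e where e: "e \<in> X" "e \<notin> S" by auto
  have XV: "X \<subseteq> V" using X by (auto simp: covers_def)
  then have eV: "e \<in> V" using e by auto
  have "covers E (V - {e}) (X - {e})" using X by (auto simp: covers_def)
  then have "tau E (V - {e}) \<le> card (X - {e})" by (rule tau_le)
  then have tau: "tau E (V - {e}) \<le> tau E V - 1" using e X by simp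
  obtain Z where Z: "covers E (V - {e}) Z" "conn E Z" "card Z = tauc E (V - {e})"
    using tauc_attained[OF noncut(1)[OF eV e(2)]] .
  have ZV: "Z \<subseteq> V - {e}" using Z by (auto simp: covers_def)
  obtain v where v: "v \<in> V" "v \<noteq> e" "(e, v) \<in> E" using V_nb[OF eV] .
  have single: "V - {e} \<noteq> {s}" for s using eV big[of e s] by auto
  have cutZ: "s \<in> Z" if "s \<in> S" "V \<inter> E `` {e} \<noteq> {s}" for s
  proof -
    have "s \<in> cuts E (V - {e})"
      using cuts_Diff_noncut[OF conn eV V_not_single that(1) _ that(2)] that(1) e(2) by blast
    then show ?thesis
      using cuts_subset_connected_cover[OF noncut(1)[OF eV e(2)] Z(1,2)] single by blast
  qed
  \<comment> \<open>One vertex must cover the edges at \<open>e\<close> and make the cover contain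
    \<open>S\<close>. If \<open>v\<close> is the only neighbour of \<open>e\<close>, it may have
    ceased to be a cut vertex, so \<open>v\<close> is added; otherwise \<open>Z\<close> already
    contains \<open>S\<close> and \<open>e\<close> is added.\<close>
  define z where "z = (if V \<inter> E `` {e} = {v} then v else e)"
  have "insert z Z \<subseteq> V" using ZV v eV by (auto simp: z_def)
  moreover have "x \<in> insert z Z \<or> y \<in> insert z Z" if "x \<in> V" "y \<in> V" "(x, y) \<in> E" for x y
  proof (cases "x = e \<or> y = e")
    case True
    then show ?thesis using that sym by (auto simp: z_def)
  next
    case False
    then show ?thesis using that Z(1) by (auto simp: covers_def)
  qed
  ultimately have cov: "covers E V (insert z Z)" by (auto simp: covers_def)
  have "S \<subseteq> insert z Z"
  proof
    fix s assume s: "s \<in> S"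
    show "s \<in> insert z Z"
    proof (cases "V \<inter> E `` {e} = {s}")
      case True
      then show ?thesis using v by (auto simp: z_def)
    qed (use cutZ s in auto)
  qed
  then have "conn E (insert z Z)" using chordal_cover_connected[OF links conn cov] by auto
  then have "tauc E V \<le> card (insert z Z)" using tauc_le cov by blast
  also have "\<dots> \<le> tauc E (V - {e}) + 1"
    using Z(3) card_insert_le_m1[of "tauc E (V - {e}) + 1" Z z] by simp
  finally have c: "tauc E V \<le> tauc E (V - {e}) + 1" .
  \<comment> \<open>Deleting \<open>e\<close> lowers both numbers by at most and at least one
    respectively; as \<open>tauc\<close> is at least \<open>tau\<close>, the ratio cannot have
    dropped.\<close>
  have "tauc E (V - {e}) * tau E V < tauc E V * (tau E V - 1)"
    using noncut(2)[OF eV e(2)] tau by (meson less_le_trans mult_le_mono2)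
  also have "\<dots> = tauc E V * tau E V - tauc E V" by (simp add: right_diff_distrib')
  also have "\<dots> \<le> tauc E V * tau E V - tau E V" using tau_le_tauc[OF conn] by simp
  also have "\<dots> \<le> (tauc E (V - {e}) + 1) * tau E V - tau E V" using c by (meson diff_le_mono mult_le_mono1)
  finally show False by simp
qed

text \<open>\<open>S\<close> contains a minimum cover, hence covers; containing all cut vertices, it
  is connected; and every connected cover contains it.\<close>

lemma S_facts: "covers E V S" "conn E S" "tauc E V = card S"
proof -
  obtain X where X: "covers E V X" "card X = tau E V" by (rule tau_attained)
  have "X \<subseteq> S" using minimum_cover_subset_cuts X by blast
  moreover have "X \<noteq> {}" using X tau_V_pos by auto
  ultimately have ne: "S \<noteq> {}" by auto
  show c: "covers E V S" using X(1) \<open>X \<subseteq> S\<close> S_sub unfolding covers_def by blast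
  then show "conn E S" using chordal_cover_connected[OF links conn] ne by blast
  then have "tauc E V \<le> card S" using tauc_le c by blast
  then show "tauc E V = card S" using card_cuts_le_tauc[OF fin conn V_not_single, of S] by auto
qed

text \<open>If all cut vertices survived, \<open>tauc\<close> would not decrease. A minimum cover
  lies in \<open>S\<close> and so avoids \<open>l\<close>, hence \<open>tau\<close> would not
  increase, against criticality.\<close>

lemma cuts_not_preserved:
  assumes "l \<in> V" "l \<notin> S"
  shows "\<not> S \<subseteq> cuts E (V - {l})"
proof
  assume S: "S \<subseteq> cuts E (V - {l})"
  have "V - {l} \<noteq> {s}" for s using assms big[of l s] by auto
  then have "card S \<le> tauc E (V - {l})"
    using card_cuts_le_tauc[of "V - {l}" S] fin noncut(1)[OF assms] S by auto
  moreover obtain X where X: "covers E V X" "card X = tau E V" by (rule tau_attained)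
  have "covers E (V - {l}) X" using X(1) minimum_cover_subset_cuts[OF X] assms
    by (auto simp: covers_def)
  then have "tau E (V - {l}) \<le> tau E V" using tau_le X(2) by metis
  ultimately have "tauc E V * tau E (V - {l}) \<le> tauc E (V - {l}) * tau E V"
    using S_facts(3) mult_le_mono by simp
  then show False using noncut(2)[OF assms] by simp
qed

text \<open>Some cut vertex is lost when \<open>l\<close> is deleted, and by
  \<open>cuts_Diff_noncut\<close> it is then the only neighbour of \<open>l\<close>. The last
  conclusion limits the number of further neighbours of \<open>u\<close> later on.\<close>

lemma noncut_pendant:
  assumes "l \<in> V" "l \<notin> S"
  obtains u where "E `` {l} = {u}" "u \<in> S" "conn E (V - {l} - {u})"
proof -
  obtain s where s: "s \<in> S" "s \<notin> cuts E (V - {l})" using cuts_not_preserved[OF assms] by auto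
  then have "V \<inter> E `` {l} = {s}"
    using cuts_Diff_noncut[OF conn assms(1) V_not_single s(1)] assms(2) by blast
  then have "E `` {l} = {s}" using EV by auto
  moreover have "conn E (V - {l} - {s})" using s assms by (auto simp: cuts_def)
  ultimately show thesis using that s(1) by blast
qed

text \<open>Criticality is compared with a single edge, whose ratio is at least 1. This serves to
  exclude the path on three vertices.\<close>

lemma tau_less_tauc: "tau E V < tauc E V"
proof -
  obtain x where x: "x \<in> V" using conn by (auto simp: conn_def)
  obtain y where y: "y \<in> V" "y \<noteq> x" "(x, y) \<in> E" using V_nb[OF x] .
  have c: "conn E {x, y}" by (rule conn_rchI[of x]) (use y in \<open>auto intro: rtrancl_on_edge\<close>)
  have "{x, y} \<subset> V" using x y big[of x y] by auto
  then have "tauc E {x, y} * tau E V < tauc E V * tau E {x, y}" using y by (intro crit c) auto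
  also have "\<dots> \<le> tauc E V * tauc E {x, y}" using tau_le_tauc[OF c] by simp
  finally show ?thesis by (simp add: mult.commute)
qed

text \<open>The ratio of \<open>G\<close> is at most the mediant of the ratios of two subgraphs around the two sides
  of a cut vertex.\<close>

lemma no_split:
  assumes X: "covers E V X" "card X = tau E V"
    and c: "c \<in> S" and w: "w \<in> V" "(c, w) \<in> E" and R: "R = {v. (w, v) \<in> rch (V - {c})}" "R \<noteq> {w}"
    and h1: "c \<in> X \<or> (\<exists>a\<in>V - R - {c}. \<exists>b\<in>V - R - {c}. (a, b) \<notin> rch (V - {c}))"
    and h2: "(\<forall>r\<in>R. (c, r) \<in> E \<longrightarrow> r \<in> X) \<or> (\<exists>w'\<in>R. w' \<noteq> w \<and> (c, w') \<in> E)"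
  shows False
proof -
  define A where "A = V - R"
  have cV: "c \<in> V" using c S_sub by auto
  have cw: "c \<noteq> w" using w irr by auto
  have XV: "X \<subseteq> V" using X by (auto simp: covers_def)
  have finX: "finite X" using XV fin finite_subset by blast
  have R': "R \<subseteq> V - {c}" "w \<in> R" "conn E R" and
    closed: "\<And>r v. r \<in> R \<Longrightarrow> v \<in> V \<Longrightarrow> (r, v) \<in> E \<Longrightarrow> v \<in> insert c R"
    using conn_reach_set[of w "V - {c}"] w cw R by auto
  have cA: "c \<in> A" using R' cV by (auto simp: A_def)
  have AV: "A \<subseteq> V" by (auto simp: A_def)
  have connA: "conn E A" unfolding A_def
    by (rule conn_Diff[OF conn cV]) (use R' closed in auto)
  obtain a where a: "a \<in> A" "a \<noteq> c"
  proof -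
    have "V - {c} \<noteq> R" using c R'(3) by (auto simp: cuts_def)
    then show thesis using that R' by (auto simp: A_def)
  qed
  have unlinked: "(x, y) \<notin> E" if "x \<in> A - {c}" "y \<in> R" for x y
    using closed[OF that(2), of x] that sym by (auto simp: A_def)
  \<comment> \<open>If \<open>c\<close> no longer cuts \<open>A\<close>, the vertex \<open>w\<close>
    is kept as a pendant neighbour to make it a cut vertex again. By \<open>h1\<close> this happens
    only when \<open>c\<close> belongs to \<open>X\<close>, so the added edge is already covered;
    \<open>R\<close> has more than one vertex, so the piece is still proper.\<close>
  obtain U1 where U1: "A \<subseteq> U1" "U1 \<subset> V" "conn E U1" "c \<in> cuts E U1" "covers E U1 (X \<inter> A)"
  proof (cases "c \<in> cuts E A")
    case True
    show thesis
    proof (rule that[of A])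
      show "A \<subset> V" using R' by (auto simp: A_def)
      show "covers E A (X \<inter> A)" using X(1) AV by (auto simp: covers_def)
    qed (use connA True in auto)
  next
    case False
    have cX: "c \<in> X"
    proof (rule ccontr)
      assume "c \<notin> X"
      then obtain a b where ab: "a \<in> A - {c}" "b \<in> A - {c}" "(a, b) \<notin> rch (V - {c})"
        using h1 by (auto simp: A_def)
      have "(a, b) \<notin> rch (A - {c})" using ab(3) rtrancl_on_subset[of "A - {c}" "V - {c}"] AV by blast
      then have "c \<in> cuts E A" using ab cA by (intro cutsI[of c A a b]) auto
      then show False using False by simp
    qed
    show thesis
    proof (rule that[of "insert w A"])
      have "R - {w} \<noteq> {}" using R(2) R'(2) by auto
      then show "insert w A \<subset> V" using AV R' w by (auto simp: A_def)
      show "conn E (insert w A)" using conn_insert[OF connA cA w(2)] .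
      have "(a, w) \<notin> rch (insert w A - {c})"
      proof
        assume "(a, w) \<in> rch (insert w A - {c})"
        then have "w \<in> A - {c}"
          by (induct rule: rtrancl_on_induct) (use a unlinked R'(2) in auto)
        then show False using R' by (auto simp: A_def)
      qed
      then show "c \<in> cuts E (insert w A)" using a cA cw by (intro cutsI[of c _ a w]) auto
      have "x \<in> X \<inter> A \<or> y \<in> X \<inter> A" if "x \<in> insert w A" "y \<in> insert w A" "(x, y) \<in> E" for x y
      proof (cases "x = w \<or> y = w")
        case True
        then have "x = c \<or> y = c" using that unlinked[of x y] unlinked[of y x] R'(2) sym irr by blast
        then show ?thesis using cX cA by auto
      next
        case False
        then show ?thesis using that X(1) AV by (auto simp: covers_def)
      qed
      then show "covers E (insert w A) (X \<inter> A)" by (auto simp: covers_def)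
    qed auto
  qed
  \<comment> \<open>If \<open>c\<close> has only one neighbour in \<open>R\<close>, then
    \<open>c\<close> is kept as a pendant vertex, lest \<open>w\<close> cease to be a cut vertex. By
    \<open>h2\<close> the added edge is covered from its end in \<open>R\<close>.\<close>
  obtain U2 where U2: "R \<subseteq> U2" "U2 \<subset> V" "conn E U2" "covers E U2 (X \<inter> R)"
    "c \<in> U2 \<or> (\<exists>w'\<in>R. w' \<noteq> w \<and> (c, w') \<in> E)"
  proof (cases "\<exists>w'\<in>R. w' \<noteq> w \<and> (c, w') \<in> E")
    case True
    show thesis
    proof (rule that[of R])
      show "R \<subset> V" using R' cV by auto
      show "covers E R (X \<inter> R)" using X(1) R' by (auto simp: covers_def)
    qed (use True R' in auto)
  next
    case False
    show thesis
    proof (rule that[of "insert c R"])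
      show "insert c R \<subset> V" using cV R' a by (auto simp: A_def)
      show "conn E (insert c R)" using conn_insert[OF R'(3) R'(2)] w sym by blast
      have "r \<in> X" if "r \<in> R" "(c, r) \<in> E" for r using that h2 False by auto
      then have "x \<in> X \<inter> R \<or> y \<in> X \<inter> R" if "x \<in> insert c R" "y \<in> insert c R" "(x, y) \<in> E" for x y
        using that X(1) R' sym irr unfolding covers_def by blast
      then show "covers E (insert c R) (X \<inter> R)" by (auto simp: covers_def)
    qed auto
  qed
  \<comment> \<open>Each cut vertex other than \<open>c\<close> separates \<open>c\<close> from some
    \<open>q\<close>. This \<open>q\<close> lies on the same side as the cut vertex, since the other
    side is joined to \<open>c\<close> without it.\<close>
  have far: "\<exists>q. q \<in> V \<and> q \<noteq> s \<and> (c, q) \<notin> rch (V - {s})" if "s \<in> S" "s \<noteq> c" for s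
    using cutsE[OF that(1) cV] that(2) by blast
  have "A \<inter> S \<subseteq> cuts E U1"
  proof
    fix s assume s: "s \<in> A \<inter> S"
    show "s \<in> cuts E U1"
    proof (cases "s = c")
      case False
      then obtain q where q: "q \<in> V" "q \<noteq> s" "(c, q) \<notin> rch (V - {s})" using far s by blast
      have "q \<notin> R"
      proof
        assume "q \<in> R"
        then have "(w, q) \<in> rch R" using R' by (auto simp: conn_def)
        then have "(w, q) \<in> rch (V - {s})" by (rule rtrancl_on_subset[rotated]) (use R' s in \<open>auto simp: A_def\<close>)
        moreover have "c \<in> V - {s}" using cV False by auto
        ultimately have "(c, q) \<in> rch (V - {s})" using w by (auto intro: converse_rtrancl_on_into_rtrancl_on)
        then show False using q by simp
      qed
      moreover have "(c, q) \<notin> rch (U1 - {s})"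
        using q(3) rtrancl_on_subset[of "U1 - {s}" "V - {s}"] U1(2) by blast
      ultimately show ?thesis using q s U1(1) cA False by (intro cutsI[of s _ c q]) (auto simp: A_def)
    qed (use U1 in simp)
  qed
  moreover have "R \<inter> S \<subseteq> cuts E U2"
  proof
    fix s assume s: "s \<in> R \<inter> S"
    then have sc: "s \<noteq> c" using R' by auto
    then obtain q where q: "q \<in> V" "q \<noteq> s" "(c, q) \<notin> rch (V - {s})" using far s by blast
    have qR: "q \<in> R"
    proof (rule ccontr)
      assume "q \<notin> R"
      then have "(c, q) \<in> rch A" using connA cA q by (auto simp: conn_def A_def)
      then have "(c, q) \<in> rch (V - {s})" by (rule rtrancl_on_subset[rotated]) (use s in \<open>auto simp: A_def\<close>)
      then show False using q by simp
    qed
    have sub: "(x, q) \<notin> rch (U2 - {s})" if "(x, q) \<notin> rch (V - {s})" for x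
      using that rtrancl_on_subset[of "U2 - {s}" "V - {s}"] U2(2) by blast
    show "s \<in> cuts E U2"
    proof (cases "c \<in> U2")
      case True
      then show ?thesis using s sc q qR U2(1) sub by (intro cutsI[of s _ c q]) auto
    next
      case False
      then obtain w' where w': "w' \<in> R" "w' \<noteq> w" "(c, w') \<in> E" using U2(5) by auto
      \<comment> \<open>With \<open>c\<close> absent, a neighbour of \<open>c\<close> in
        \<open>R\<close> other than \<open>s\<close> takes its place; two neighbours are available,
        so one differs from \<open>s\<close>.\<close>
      obtain x where x: "x \<in> R" "x \<noteq> s" "(c, x) \<in> E" using w' w R'(2) by metis
      have "(x, q) \<notin> rch (V - {s})"
      proof
        assume *: "(x, q) \<in> rch (V - {s})"
        have "c \<in> V - {s}" using cV sc by auto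
        then have "(c, q) \<in> rch (V - {s})" using * x by (auto intro: converse_rtrancl_on_into_rtrancl_on)
        then show False using q by simp
      qed
      then show ?thesis using s q qR x U2(1) sub by (intro cutsI[of s _ x q]) auto
    qed
  qed
  moreover have n1: "U1 \<noteq> {s}" and n2: "U2 \<noteq> {s}" for s
    using U1(1) U2(1) a cA R(2) R'(2) by auto
  ultimately have "card (A \<inter> S) \<le> tauc E U1" "card (R \<inter> S) \<le> tauc E U2"
    using card_cuts_le_tauc U1(2,3) U2(2,3) fin by (meson finite_subset psubset_imp_subset)+
  moreover have "card S = card (A \<inter> S) + card (R \<inter> S)"
  proof -
    have "S = (A \<inter> S) \<union> (R \<inter> S)" using S_sub R' by (auto simp: A_def)
    moreover have "(A \<inter> S) \<inter> (R \<inter> S) = {}" by (auto simp: A_def)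
    ultimately show ?thesis using card_Un_disjoint finite_subset[OF S_sub fin] by (metis finite_Un)
  qed
  ultimately have "tauc E V * tau E V \<le> (tauc E U1 + tauc E U2) * tau E V"
    using S_facts(3) by (intro mult_le_mono1) simp
  also have "\<dots> < tauc E V * tau E U1 + tauc E V * tau E U2"
    using crit[OF U1(2,3)] crit[OF U2(2,3)] n1 n2 by (auto simp: add_mult_distrib intro: add_strict_mono)
  also have "\<dots> = tauc E V * (tau E U1 + tau E U2)" by (simp add: add_mult_distrib2)
  also have "\<dots> \<le> tauc E V * tau E V"
  proof (rule mult_le_mono2)
    have "X = (X \<inter> A) \<union> (X \<inter> R)" "(X \<inter> A) \<inter> (X \<inter> R) = {}" using XV R' by (auto simp: A_def)
    then have "card X = card (X \<inter> A) + card (X \<inter> R)"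
      using card_Un_disjoint finX by (metis finite_Un)
    then show "tau E U1 + tau E U2 \<le> tau E V"
      using X(2) tau_le[OF U1(5)] tau_le[OF U2(4)] by simp
  qed
  finally show False by simp
qed

lemma special_structure_exists: "\<exists>X Y L. special_structure E V X Y L"
proof -
  obtain X where X: "covers E V X" "card X = tau E V" by (rule tau_attained)
  have XS: "X \<subseteq> S" using minimum_cover_subset_cuts X by blast
  define Y where "Y = S - X"
  define L where "L = V - S"
  have cov: "x \<in> X \<or> y \<in> X" if "(x, y) \<in> E" for x y using X(1) that EV by (auto simp: covers_def)
  have S2: "\<exists>b. b \<noteq> a \<and> (s, b) \<in> E" if "s \<in> S" for s a
    using cuts_two_neighbours[OF conn that V_not_single] by metis
  have other: "{v. (w, v) \<in> rch (V - {c})} \<noteq> {w}" if w: "w \<in> S" "(c, w) \<in> E" for c w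
  proof -
    obtain b where b: "b \<noteq> c" "(w, b) \<in> E" using S2[OF w(1)] by blast
    then have "(w, b) \<in> rch (V - {c})" using w irr EV by (intro rtrancl_on_edge) auto
    then show ?thesis using b irr by (metis mem_Collect_eq singletonD)
  qed
  \<comment> \<open>\<open>h2\<close> holds for \<open>c = x\<close> and \<open>w = y\<close>: a
    neighbour of \<open>x\<close> outside \<open>X\<close> cannot be \<open>y\<close>, so it is the
    second neighbour demanded there.\<close>
  have indep: "(x, y) \<notin> E" if "x \<in> X" "y \<in> X" for x y
  proof
    assume e: "(x, y) \<in> E"
    show False
      by (rule no_split[OF X, of x y]) (use that e XS S_sub other in auto)
  qed
  have edges: "E \<subseteq> X \<times> (Y \<union> L) \<union> (Y \<union> L) \<times> X"
    using cov indep EV by (fastforce simp: Y_def L_def)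
  have disj: "X \<inter> Y = {}" "X \<inter> L = {}" "Y \<inter> L = {}" using XS by (auto simp: Y_def L_def)
  have bip: "x \<in> X \<longleftrightarrow> y \<notin> X" if "(x, y) \<in> E" for x y using that cov indep by blast
  have unlinked: "(a, b) \<notin> rch (V - {c})" if "(c, a) \<in> E" "(c, b) \<in> E" "a \<noteq> b" for a b c
  proof (rule independent_neighbours_unlinked[OF links _ that])
    show "(u, v) \<notin> E" if "(c, u) \<in> E" "(c, v) \<in> E" for u v
      using that bip by blast
  qed
  have "special_structure E V X Y L"
  proof
    show "V = X \<union> Y \<union> L" using XS S_sub by (auto simp: Y_def L_def)
    show "\<exists>a b. a \<noteq> b \<and> E `` {y} = {a, b} \<and> (a, b) \<notin> rch (V - {y})" if y: "y \<in> Y" for y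
    proof -
      have yS: "y \<in> S" "y \<notin> X" using y by (auto simp: Y_def)
      obtain a where a: "(y, a) \<in> E" using S2[OF yS(1)] by blast
      obtain b where b: "(y, b) \<in> E" "b \<noteq> a" using S2[OF yS(1)] by blast
      have nbX: "r \<in> X" if "(y, r) \<in> E" for r using cov[OF that] yS by auto
      \<comment> \<open>A third neighbour would permit a split at \<open>y\<close> towards
        \<open>a\<close>: then \<open>b\<close> and \<open>d\<close> both remain on the other side
        and are separated by \<open>y\<close>, which gives \<open>h1\<close>.\<close>
      have "d \<in> {a, b}" if d: "(y, d) \<in> E" for d
      proof (rule ccontr)
        assume nd: "d \<notin> {a, b}"
        have bd: "b \<in> V" "d \<in> V" "a \<in> V" using a b d EV by auto
        show False
        proof (rule no_split[OF X yS(1), of a])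
          show "{v. (a, v) \<in> rch (V - {y})} \<noteq> {a}" using other a nbX XS by blast
          have "b \<in> V - {v. (a, v) \<in> rch (V - {y})} - {y}" "d \<in> V - {v. (a, v) \<in> rch (V - {y})} - {y}"
            using bd unlinked[OF a b(1)] unlinked[OF a d] nd b d irr by auto
          moreover have "(b, d) \<notin> rch (V - {y})" using unlinked[OF b(1) d] nd by auto
          ultimately show "y \<in> X \<or> (\<exists>a'\<in>V - {v. (a, v) \<in> rch (V - {y})} - {y}.
            \<exists>b\<in>V - {v. (a, v) \<in> rch (V - {y})} - {y}. (a', b) \<notin> rch (V - {y}))" by blast
        qed (use bd(3) a nbX in blast)+
      qed
      then have "E `` {y} = {a, b}" using a b by auto
      then show ?thesis using unlinked[OF a b(1)] b(2) by metis
    qed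
    show "\<exists>x. E `` {l} = {x}" if "l \<in> L" for l
      using noncut_pendant[of l] that by (auto simp: L_def)
    show "if \<exists>y\<in>Y. \<exists>y'\<in>Y. y \<noteq> y' \<and> (x, y) \<in> E \<and> (x, y') \<in> E
        then E `` {x} \<inter> L = {} else \<exists>l. E `` {x} \<inter> L = {l}" if x: "x \<in> X" for x
    proof (cases "E `` {x} \<inter> L = {}")
      case True
      obtain a where a: "(x, a) \<in> E" using S2 XS x by blast
      obtain b where b: "(x, b) \<in> E" "b \<noteq> a" using S2 XS x by blast
      have "v \<in> Y" if "(x, v) \<in> E" for v
        using that bip[OF that] x True EV by (auto simp: Y_def L_def)
      then have "a \<in> Y" "b \<in> Y" using a b by auto
      then show ?thesis using a b True by auto
    next
      case False
      then obtain l where l: "(x, l) \<in> E" "l \<in> L" by auto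
      then have lV: "l \<in> V" "l \<notin> S" by (auto simp: L_def)
      obtain u where u: "E `` {l} = {u}" "u \<in> S" "conn E (V - {l} - {u})"
        using noncut_pendant[OF lV] .
      have ux: "u = x" using u(1) sym[OF l(1)] by auto
      \<comment> \<open>Without \<open>l\<close> the vertex \<open>x\<close> no longer cuts, while
        any two distinct neighbours of \<open>x\<close> are separated by \<open>x\<close>.\<close>
      have same: "v = w" if "(x, v) \<in> E" "(x, w) \<in> E" "v \<noteq> l" "w \<noteq> l" for v w
      proof (rule ccontr)
        assume "v \<noteq> w"
        then have "(v, w) \<notin> rch (V - {x})" using unlinked that by blast
        moreover have "(v, w) \<in> rch (V - {l} - {x})"
        proof -
          have "v \<in> V - {l} - {x}" "w \<in> V - {l} - {x}" using that EV irr by auto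
          then show ?thesis using u(3) unfolding ux conn_def by blast
        qed
        ultimately show False using rtrancl_on_subset[of "V - {l} - {x}" "V - {x}"] by blast
      qed
      have "l' = l" if l': "(x, l') \<in> E" "l' \<in> L" for l'
      proof (rule ccontr)
        assume ne: "l' \<noteq> l"
        have l'V: "l' \<in> V" "l' \<notin> S" using l' by (auto simp: L_def)
        obtain u' where "E `` {l'} = {u'}" using noncut_pendant[OF l'V] .
        then have nl': "E `` {l'} = {x}" using sym[OF l'(1)] by auto
        \<comment> \<open>A second pendant vertex at \<open>x\<close> would be isolated in this
          connected set. The graph would be a path on three vertices, whose only cut vertex gives
          \<open>tauc\<close> at most 1.\<close>
        have "V - {l} - {x} = {l'}"
        proof (rule ccontr)
          assume "V - {l} - {x} \<noteq> {l'}"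
          moreover have "l' \<in> V - {l} - {x}" using l' l'V ne irr by auto
          ultimately show False using conn_neighbour[of E "V - {l} - {x}" l'] u(3) nl' ux
            by (metis Diff_iff Image_singleton_iff singletonD insertI1)
        qed
        then have "S \<subseteq> {x}" using S_sub l'V lV by auto
        then have "card S \<le> card {x}" by (intro card_mono) auto
        then show False using tau_less_tauc tau_V_pos S_facts(3) by simp
      qed
      then have "E `` {x} \<inter> L = {l}" using l by blast
      moreover have "\<not> (\<exists>y\<in>Y. \<exists>y'\<in>Y. y \<noteq> y' \<and> (x, y) \<in> E \<and> (x, y') \<in> E)"
      proof safe
        fix y y' assume y: "y \<in> Y" "y' \<in> Y" "(x, y) \<in> E" "(x, y') \<in> E" "y \<noteq> y'"
        then have "y \<noteq> l" "y' \<noteq> l" using l(2) disj(3) by auto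
        then show False using same y by blast
      qed
      ultimately show ?thesis by auto
    qed
  qed (use fin conn edges disj in auto)
  then show ?thesis by blast
qed

end

section \<open>Subgraphs of special trees\<close>

text \<open>Induction in which the step chooses the next element, so that a cover can be built up in
  an order suited to connectivity.\<close>

lemma subset_grow_induct:
  assumes "finite X" "x0 \<in> X" "P {x0}"
    and step: "\<And>W. W \<subset> X \<Longrightarrow> W \<noteq> {} \<Longrightarrow> P W \<Longrightarrow> \<exists>x\<in>X - W. P (insert x W)"
  shows "P X"
proof -
  have ex: "\<exists>W \<subseteq> X. W \<noteq> {} \<and> P W \<and> card W = Suc k" if "k < card X" for k
    using that
  proof (induct k)
    case 0
    then show ?case using assms(2,3) by (intro exI[of _ "{x0}"]) auto
  next
    case (Suc k)
    then obtain W where W: "W \<subseteq> X" "W \<noteq> {}" "P W" "card W = Suc k" by auto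
    then have "W \<subset> X" using Suc by auto
    then obtain x where "x \<in> X - W" "P (insert x W)" using step W by blast
    moreover have "finite W" using W assms(1) finite_subset by blast
    ultimately show ?case using W by (intro exI[of _ "insert x W"]) auto
  qed
  have pos: "card X > 0" using assms(1,2) card_gt_0_iff by blast
  then obtain W where "W \<subseteq> X" "P W" "card W = card X" using ex[of "card X - 1"] by auto
  then show ?thesis using card_subset_eq assms(1) by blast
qed

text \<open>The complement of a cover is independent, so the rest of the cover is reached in at most
  two steps.\<close>

lemma cover_extend:
  assumes "conn E U" "covers E U X" "W \<subset> X" "W \<noteq> {}"
  shows "\<exists>x\<in>X - W. \<exists>w\<in>W. (w, x) \<in> E \<or> (\<exists>t\<in>U - X. (w, t) \<in> E \<and> (t, x) \<in> E)"
proof -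
  define T where "T = W \<union> {t \<in> U - X. \<exists>w\<in>W. (w, t) \<in> E}"
  have XU: "X \<subseteq> U" using assms by (auto simp: covers_def)
  then have "T \<subseteq> U" "T \<noteq> {}" "T \<noteq> U" using assms by (auto simp: T_def)
  then obtain t z where tz: "t \<in> T" "z \<in> U" "z \<notin> T" "(t, z) \<in> E" using conn_edge_out[OF assms(1)] by blast
  show ?thesis
  proof (cases "t \<in> W")
    case True
    then have "z \<in> X - W" using tz by (auto simp: T_def)
    then show ?thesis using True tz by blast
  next
    case False
    then obtain w where w: "w \<in> W" "(w, t) \<in> E" "t \<in> U - X" using tz by (auto simp: T_def)
    then have "z \<in> X - W" using tz assms(2) by (auto simp: T_def covers_def)
    then show ?thesis using w tz by blast
  qed
qed

context sgraph
begin

text \<open>Growing a minimum cover with \<open>cover_extend\<close>, each new vertex costs itself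
  and at most one connecting vertex; the first needs no connection, whence the saving of
  one.\<close>

lemma tauc_le_two_tau:
  assumes "finite U" "conn E U" "u \<in> U" "v \<in> U" "(u, v) \<in> E"
  shows "tauc E U + 1 \<le> 2 * tau E U"
proof -
  obtain C where C: "covers E U C" "card C = tau E U" by (rule tau_attained)
  have CU: "C \<subseteq> U" using C by (auto simp: covers_def)
  then have fC: "finite C" using assms(1) finite_subset by blast
  obtain c where c: "c \<in> C" using C(1) assms(3-5) unfolding covers_def by blast
  have "\<exists>B. C \<subseteq> B \<and> B \<subseteq> U \<and> conn E B \<and> card B + 1 \<le> 2 * card C"
  proof (rule subset_grow_induct[where P = "\<lambda>W. \<exists>B. W \<subseteq> B \<and> B \<subseteq> U \<and> conn E B \<and> card B + 1 \<le> 2 * card W", OF fC c])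
    have "conn E {c}" by (rule conn_rchI[of c]) auto
    then show "\<exists>B. {c} \<subseteq> B \<and> B \<subseteq> U \<and> conn E B \<and> card B + 1 \<le> 2 * card {c}"
      using c CU by (intro exI[of _ "{c}"]) auto
  next
    fix W assume W: "W \<subset> C" "W \<noteq> {}" "\<exists>B. W \<subseteq> B \<and> B \<subseteq> U \<and> conn E B \<and> card B + 1 \<le> 2 * card W"
    then obtain B where B: "W \<subseteq> B" "B \<subseteq> U" "conn E B" "card B + 1 \<le> 2 * card W" by auto
    have fW: "finite W" "finite B" using W(1) B(2) fC assms(1) finite_subset by blast+
    obtain x w where xw: "x \<in> C - W" "w \<in> W" "(w, x) \<in> E \<or> (\<exists>t\<in>U - C. (w, t) \<in> E \<and> (t, x) \<in> E)"
      using cover_extend[OF assms(2) C(1) W(1,2)] by blast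
    have cW: "card (insert x W) = card W + 1" using xw fW by simp
    from xw(3) show "\<exists>x\<in>C - W. \<exists>B. insert x W \<subseteq> B \<and> B \<subseteq> U \<and> conn E B \<and> card B + 1 \<le> 2 * card (insert x W)"
    proof
      assume "(w, x) \<in> E"
      then have "conn E (insert x B)" using conn_insert[OF B(3)] xw B by blast
      moreover have "card (insert x B) \<le> card B + 1" using card_insert_le_m1[of "card B + 1" B x] by simp
      ultimately show ?thesis using xw CU B cW
        by (intro bexI[of _ x] exI[of _ "insert x B"]) auto
    next
      assume "\<exists>t\<in>U - C. (w, t) \<in> E \<and> (t, x) \<in> E"
      then obtain t where t: "t \<in> U" "(w, t) \<in> E" "(t, x) \<in> E" by auto
      have "conn E (insert t B)" using conn_insert[OF B(3)] xw B t by blast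
      then have "conn E (insert x (insert t B))" using conn_insert[of "insert t B" t x] t by simp
      moreover have "card (insert x (insert t B)) \<le> card B + 2"
        using card_insert_le_m1[of "card B + 1" B t] card_insert_le_m1[of "card B + 2" "insert t B" x] by simp
      ultimately show ?thesis using xw CU B cW t
        by (intro bexI[of _ x] exI[of _ "insert x (insert t B)"]) auto
    qed
  qed
  then obtain B where B: "C \<subseteq> B" "B \<subseteq> U" "conn E B" "card B + 1 \<le> 2 * card C" by auto
  then have "covers E U B" using C(1) unfolding covers_def by blast
  then show ?thesis using tauc_le B C(2) by (metis add_le_mono1 le_trans)
qed

text \<open>An edge between two vertices of degree 1 would be the whole connected graph. A walk that
  enters a vertex of degree 1 must turn back, so such vertices can be bypassed.\<close>

lemma nonpendant_connected_cover:
  assumes "conn E U" "\<And>a b. U \<noteq> {a, b}"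
  defines "D \<equiv> {v \<in> U. \<exists>a\<in>U. \<exists>b\<in>U. a \<noteq> b \<and> (v, a) \<in> E \<and> (v, b) \<in> E}"
  shows "covers E U D" "conn E D"
proof -
  have unique: "a = b" if "v \<in> U" "v \<notin> D" "a \<in> U" "b \<in> U" "(v, a) \<in> E" "(v, b) \<in> E" for v a b
    using that unfolding D_def by blast
  have edge: "u \<in> D \<or> v \<in> D" if uv: "u \<in> U" "v \<in> U" "(u, v) \<in> E" for u v
  proof (rule ccontr)
    assume nD: "\<not> (u \<in> D \<or> v \<in> D)"
    obtain w z where wz: "w \<in> {u, v}" "z \<in> U" "z \<notin> {u, v}" "(w, z) \<in> E"
      using conn_edge_out[OF assms(1), of "{u, v}"] uv assms(2)[of u v] by blast
    then consider "(u, z) \<in> E" "z \<noteq> v" | "(v, z) \<in> E" "z \<noteq> u" by auto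
    then show False
      by cases (use unique[of u v z] unique[of v u z] nD uv wz(2) sym[OF uv(3)] in simp_all)
  qed
  then show "covers E U D" by (auto simp: covers_def D_def)
  obtain u where u: "u \<in> U" using assms by (auto simp: conn_def)
  moreover obtain v where "v \<in> U" "(u, v) \<in> E"
    using conn_neighbour[OF assms(1) u] assms(2)[of u u] by auto
  ultimately obtain c where c: "c \<in> D" using edge by blast
  show "conn E D"
  proof (rule conn_rchI[OF c])
    fix v assume v: "v \<in> D"
    have "(c, v) \<in> rch U" using c v assms(1) by (auto simp: conn_def D_def)
    \<comment> \<open>For a vertex outside \<open>D\<close> the invariant records the neighbour to
      which the walk has to return.\<close>
    then have "if v \<in> D then (c, v) \<in> rch D else \<exists>d\<in>D. (v, d) \<in> E \<and> (c, d) \<in> rch D"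
    proof (induct rule: rtrancl_on_induct)
      case base
      then show ?case using c by auto
    next
      case (step y z)
      show ?case
      proof (cases "y \<in> D")
        case True
        then show ?thesis using step sym[of y z] by (auto intro: rtrancl_on_into_rtrancl_on)
      next
        case False
        then obtain d where d: "d \<in> D" "(y, d) \<in> E" "(c, d) \<in> rch D" using step by auto
        then have "z = d" using unique[of y z d] step False by (auto simp: D_def)
        then show ?thesis using d by auto
      qed
    qed
    then show "(c, v) \<in> rch D" using v by simp
  qed
qed

end

context special_structure
begin

lemma EV: "E \<subseteq> V \<times> V"
  using edges V_eq by auto

lemma X_adj: "x \<in> X \<Longrightarrow> (x, v) \<in> E \<Longrightarrow> v \<in> Y \<union> L"
  using edges disj by auto

lemma nonX_adj: "t \<in> Y \<union> L \<Longrightarrow> (t, v) \<in> E \<Longrightarrow> v \<in> X"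
  using edges disj by auto

lemma fin_XY: "finite X" "finite Y"
  using fin V_eq by auto

lemma tau_le_card_X: "W \<subseteq> V \<Longrightarrow> F \<subseteq> E \<Longrightarrow> tau F W \<le> card X"
proof -
  assume W: "W \<subseteq> V" "F \<subseteq> E"
  have "covers F W (X \<inter> W)" using edges W by (auto simp: covers_def)
  then have "tau F W \<le> card (X \<inter> W)" by (rule tau_le)
  also have "\<dots> \<le> card X" by (intro card_mono fin_XY) auto
  finally show ?thesis .
qed

text \<open>This is the edge count of a connected graph with vertex set \<open>X\<close> and edges
  given by \<open>Y\<close>: each added vertex is attached through a fresh \<open>t\<close> in
  \<open>Y\<close>, both of whose neighbours now lie in the set. A vertex of \<open>L\<close> cannot
  connect, having one neighbour only.\<close>

lemma card_X_le:
  assumes "X \<noteq> {}"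
  shows "card X \<le> card Y + 1"
proof -
  obtain x0 where x0: "x0 \<in> X" using assms by auto
  have "card X \<le> card {y \<in> Y. E `` {y} \<subseteq> X} + 1"
  proof (rule subset_grow_induct[where P = "\<lambda>W. card W \<le> card {y \<in> Y. E `` {y} \<subseteq> W} + 1", OF fin_XY(1) x0])
    fix W assume W: "W \<subset> X" "W \<noteq> {}" "card W \<le> card {y \<in> Y. E `` {y} \<subseteq> W} + 1"
    have "covers E V X" using edges V_eq by (auto simp: covers_def)
    then obtain x w where xw: "x \<in> X - W" "w \<in> W" "(w, x) \<in> E \<or> (\<exists>t\<in>V - X. (w, t) \<in> E \<and> (t, x) \<in> E)"
      using cover_extend[OF conn _ W(1,2)] by blast
    have "w \<in> X" "x \<in> X" using xw W(1) by auto
    then have "(w, x) \<notin> E" using X_adj[of w x] disj by auto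
    then obtain t where t: "t \<in> Y \<union> L" "(w, t) \<in> E" "(t, x) \<in> E" using xw(3) V_eq by auto
    have tw: "(t, w) \<in> E" and wx: "w \<noteq> x" using t sym xw by auto
    have mem: "w \<in> E `` {t}" "x \<in> E `` {t}" using tw t(3) by auto
    have "t \<notin> L" using L_nb[of t] mem wx by (metis singletonD)
    then have tY: "t \<in> Y" using t by auto
    then have nb: "E `` {t} = {w, x}" using Y_nb[OF tY] mem wx by (elim exE conjE) auto
    have "insert t {y \<in> Y. E `` {y} \<subseteq> W} \<subseteq> {y \<in> Y. E `` {y} \<subseteq> insert x W}" using tY nb xw by auto
    then have "card (insert t {y \<in> Y. E `` {y} \<subseteq> W}) \<le> card {y \<in> Y. E `` {y} \<subseteq> insert x W}"
      using fin_XY by (intro card_mono) auto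
    moreover have "t \<notin> {y \<in> Y. E `` {y} \<subseteq> W}" using nb xw by auto
    ultimately have "card {y \<in> Y. E `` {y} \<subseteq> W} + 1 \<le> card {y \<in> Y. E `` {y} \<subseteq> insert x W}"
      using fin_XY by simp
    moreover have "finite W" using W(1) fin_XY finite_subset by blast
    ultimately show "\<exists>x\<in>X - W. card (insert x W) \<le> card {y \<in> Y. E `` {y} \<subseteq> insert x W} + 1"
      using xw W(3) by (intro bexI[of _ x]) auto
  qed auto
  also have "card {y \<in> Y. E `` {y} \<subseteq> X} \<le> card Y" using fin_XY by (intro card_mono) auto
  finally show ?thesis by simp
qed

text \<open>A vertex of \<open>Y\<close> cuts by assumption and one of \<open>X\<close> with a
  pendant neighbour cuts that neighbour off; the remaining vertices of \<open>X\<close> separate two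
  of their neighbours in \<open>Y\<close>.\<close>

lemma XY_cuts:
  assumes "\<And>a b. V \<noteq> {a, b}"
  shows "X \<union> Y \<subseteq> cuts E V"
proof
  fix s assume "s \<in> X \<union> Y"
  then consider "s \<in> Y" | "s \<in> X" "E `` {s} \<inter> L = {}" | l where "s \<in> X" "l \<in> L" "(s, l) \<in> E" by blast
  then show "s \<in> cuts E V"
  proof cases
    case 1
    then obtain a b where ab: "E `` {s} = {a, b}" "(a, b) \<notin> rch (V - {s})" using Y_nb by blast
    then have "(s, a) \<in> E" "(s, b) \<in> E" by auto
    moreover from this have "a \<in> V - {s}" "b \<in> V - {s}" "s \<in> V" using EV irr by auto
    ultimately show ?thesis using ab by (intro cutsI[of s V a b]) auto
  next
    case 2
    then obtain y y' where y: "y \<in> Y" "y' \<in> Y" "y \<noteq> y'" "(s, y) \<in> E" "(s, y') \<in> E"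
      using X_nb[of s] by (auto split: if_splits)
    obtain a b where ab: "a \<noteq> b" "E `` {y'} = {a, b}" "(a, b) \<notin> rch (V - {y'})" using Y_nb[OF y(2)] by blast
    have "s \<in> E `` {y'}" using sym[OF y(5)] by auto
    then have "s = a \<or> s = b" using ab(2) by simp
    then obtain z where z: "E `` {y'} = {s, z}" "(s, z) \<notin> rch (V - {y'})"
      using ab(2,3) that[of a] that[of b] rch_sym[of b a "V - {y'}"] by (elim disjE) (auto simp: insert_commute)
    have "(y, y') \<notin> rch (V - {s})"
    proof
      assume *: "(y, y') \<in> rch (V - {s})"
      \<comment> \<open>A walk from \<open>y\<close> that avoids \<open>s\<close> can enter
        \<open>y'\<close> only from its other neighbour \<open>z\<close>. Its part before that joins
        \<open>s\<close>, through \<open>y\<close>, to \<open>z\<close> without \<open>y'\<close>,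
        which \<open>Y_nb\<close> forbids.\<close>
      have "(y, z) \<in> rch (V - {y'}) \<or> (v \<noteq> y' \<and> (y, v) \<in> rch (V - {y'}))"
        if "(y, v) \<in> rch (V - {s})" for v
        using that
      proof (induct rule: rtrancl_on_induct)
        case base
        then show ?case using y by auto
      next
        case (step u v)
        show ?case
        proof (cases "v = y'")
          case True
          then have "u \<in> E `` {y'}" using step sym by auto
          then have "u = z" using z(1) step by auto
          then show ?thesis using step by auto
        next
          case False
          then show ?thesis using step by (auto intro: rtrancl_on_into_rtrancl_on)
        qed
      qed
      from this[OF *] have "(y, z) \<in> rch (V - {y'})" by simp
      moreover have "s \<in> V - {y'}" using 2 y irr V_eq by auto
      ultimately have "(s, z) \<in> rch (V - {y'})" using y by (auto intro: converse_rtrancl_on_into_rtrancl_on)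
      then show False using z by simp
    qed
    then show ?thesis using 2 y irr V_eq by (intro cutsI[of s V y y']) auto
  next
    case 3
    obtain v where v: "v \<in> V" "v \<noteq> s" "v \<noteq> l" using assms[of s l] 3 V_eq by blast
    have "s \<in> E `` {l}" using sym[OF 3(3)] by auto
    then have nl: "E `` {l} = {s}" using L_nb[OF 3(2)] by (metis singletonD)
    have "(l, v) \<notin> rch (V - {s})"
    proof
      assume "(l, v) \<in> rch (V - {s})"
      then have "v = l" by (induct rule: rtrancl_on_induct) (use nl in auto)
      then show False using v by simp
    qed
    then show ?thesis using 3 v V_eq irr by (intro cutsI[of s V l v]) auto
  qed
qed

lemma X_nonempty:
  assumes "E \<noteq> {}" shows "X \<noteq> {}"
  using assms edges by auto

lemma no_singleton:
  assumes "E \<noteq> {}" shows "V \<noteq> {s}"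
  using assms EV irr by auto

text \<open>\<open>XY_cuts\<close> fails for the single edge, which has no cut vertices; there
  \<open>X\<close> is one vertex, \<open>Y\<close> is empty, and positivity of \<open>tau\<close>
  suffices.\<close>

lemma card_XY_le_tauc:
  assumes "E \<noteq> {}"
  shows "card X + card Y \<le> tauc E V"
proof -
  have XY: "card X + card Y = card (X \<union> Y)" using card_Un_disjoint fin_XY disj(1) by metis
  show ?thesis
  proof (cases "\<exists>a b. V = {a, b}")
    case False
    then show ?thesis
      using card_cuts_le_tauc[OF fin conn no_singleton[OF assms] XY_cuts] XY by auto
  next
    case True
    obtain p q where pq: "(p, q) \<in> E" using assms by auto
    obtain x v where xv: "x \<in> X" "v \<in> Y \<union> L" "(x, v) \<in> E"
      using subsetD[OF edges pq] pq sym[OF pq] that[of p q] that[of q p] by auto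
    have "x \<in> V" "v \<in> V" "x \<noteq> v" using xv EV irr by auto
    then have V: "V = {x, v}" using True by auto
    have "v \<notin> Y"
    proof
      assume "v \<in> Y"
      then obtain a b where ab: "a \<noteq> b" "E `` {v} = {a, b}" using Y_nb by blast
      have "E `` {v} \<subseteq> {x}" using V EV irr by auto
      then show False using ab by auto
    qed
    then have "X \<union> Y \<subseteq> {x}" using V V_eq xv disj by auto
    then have "card (X \<union> Y) \<le> card {x}" by (intro card_mono) auto
    moreover have "0 < tau E V" using tau_pos[OF fin _ _ xv(3)] V by auto
    ultimately show ?thesis using XY tau_le_tauc[OF conn] by simp
  qed
qed

text \<open>The vertices of degree at least 2 of a connected subgraph form a connected vertex cover; if they
  comprise all of \<open>X \<union> Y\<close>, then no edge is missing.\<close>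

lemma subgraph_tauc_less:
  assumes F: "F \<subseteq> E" "\<And>u v. (u, v) \<in> F \<Longrightarrow> (v, u) \<in> F" "F \<noteq> {}"
    and K: "K \<subseteq> V" "conn F K" "F \<noteq> E"
  shows "tauc F K < card X + card Y"
proof -
  interpret F: sgraph F using F irr by unfold_locales auto
  have finK: "finite K" using K fin finite_subset by blast
  have Ene: "E \<noteq> {}" using F by auto
  have XY: "card X + card Y = card (X \<union> Y)" using card_Un_disjoint fin_XY disj(1) by metis
  show ?thesis
  proof (cases "\<exists>a b. K = {a, b}")
    case True
    then obtain a b where ab: "K = {a, b}" by auto
    have "conn F {a}" by (rule F.conn_rchI[of a]) auto
    moreover have "covers F K {a}" using ab F.irr by (auto simp: covers_def)
    ultimately have le: "tauc F K \<le> 1" using tauc_le by fastforce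
    \<comment> \<open>Equality would make \<open>E\<close> a single edge, which the nonempty
      symmetric set \<open>F\<close> would have to contain entirely.\<close>
    have "card X + card Y \<noteq> 1"
    proof
      assume c: "card X + card Y = 1"
      then have "card X = 1" "card Y = 0" using X_nonempty[OF Ene] fin_XY card_gt_0_iff[of X] by linarith+
      then obtain x where x: "X = {x}" "Y = {}" using fin_XY card_1_singletonE by (metis card_0_eq)
      obtain l where l: "E `` {x} \<inter> L = {l}" using X_nb[of x] x by auto
      have xl: "v = l" if "v \<in> L" "(x, v) \<in> E" for v using that l by auto
      have "e = (x, l) \<or> e = (l, x)" if "e \<in> E" for e
        using subsetD[OF edges that] that x xl sym by (cases e) auto
      moreover obtain p q where pq: "(p, q) \<in> F" using F by auto
      ultimately have "E \<subseteq> {(p, q), (q, p)}" using F(1) by blast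
      then have "E \<subseteq> F" using F(2)[OF pq] pq by auto
      then show False using K(3) F(1) by auto
    qed
    moreover have "card X > 0" using X_nonempty[OF Ene] fin_XY card_gt_0_iff by blast
    ultimately show ?thesis using le by linarith
  next
    case False
    define D where "D = {v \<in> K. \<exists>a\<in>K. \<exists>b\<in>K. a \<noteq> b \<and> (v, a) \<in> F \<and> (v, b) \<in> F}"
    have D: "covers F K D" "conn F D"
      using F.nonpendant_connected_cover[OF K(2)] False unfolding D_def by blast+
    have two: "\<exists>a b. a \<noteq> b \<and> (v, a) \<in> F \<and> (v, b) \<in> F" if "v \<in> D" for v using that by (auto simp: D_def)
    have "D \<inter> L = {}"
    proof (rule ccontr)
      assume "D \<inter> L \<noteq> {}"
      then obtain l where l: "l \<in> D" "l \<in> L" by auto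
      then obtain x where x: "E `` {l} = {x}" using L_nb by blast
      obtain a b where ab: "a \<noteq> b" "(l, a) \<in> F" "(l, b) \<in> F" using two l(1) by blast
      then have "a \<in> E `` {l}" "b \<in> E `` {l}" using F(1) by auto
      then show False using x ab(1) by simp
    qed
    then have sub: "D \<subseteq> X \<union> Y" using K V_eq by (auto simp: D_def)
    have "D \<noteq> X \<union> Y"
    proof
      assume eq: "D = X \<union> Y"
      have y: "(y, v) \<in> F" if yv: "y \<in> Y" "(y, v) \<in> E" for y v
      proof -
        obtain a b where ab: "E `` {y} = {a, b}" using Y_nb yv(1) by blast
        obtain a' b' where ab': "a' \<noteq> b'" "(y, a') \<in> F" "(y, b') \<in> F" using two[of y] eq yv(1) by blast
        then have "a' \<in> E `` {y}" "b' \<in> E `` {y}" "v \<in> E `` {y}" using F(1) yv by auto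
        then show ?thesis unfolding ab using ab' by auto
      qed
      \<comment> \<open>A vertex \<open>x\<close> with a pendant neighbour has at most one neighbour
        in \<open>Y\<close>, so one of its two neighbours under \<open>F\<close> is the pendant
        one.\<close>
      have l: "(x, l) \<in> F" if xl: "x \<in> X" "l \<in> L" "(x, l) \<in> E" for x l
      proof -
        obtain a b where ab: "a \<noteq> b" "(x, a) \<in> F" "(x, b) \<in> F" using two[of x] eq xl(1) by blast
        then have ab': "(x, a) \<in> E" "(x, b) \<in> E" using F(1) by auto
        have "E `` {x} \<inter> L \<noteq> {}" using xl by auto
        then obtain l' where l': "E `` {x} \<inter> L = {l'}"
          "\<not> (\<exists>y\<in>Y. \<exists>y'\<in>Y. y \<noteq> y' \<and> (x, y) \<in> E \<and> (x, y') \<in> E)"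
          using X_nb[OF xl(1)] by (auto split: if_splits)
        have L: "v = l" if "v \<in> L" "(x, v) \<in> E" for v
        proof -
          have "v \<in> E `` {x} \<inter> L" "l \<in> E `` {x} \<inter> L" using xl that by auto
          then show ?thesis using l'(1) by auto
        qed
        have "a \<in> L \<or> b \<in> L" using l'(2) ab ab' X_adj[OF xl(1)] by blast
        then show ?thesis using L[of a] L[of b] ab ab' by auto
      qed
      have "E \<subseteq> F"
      proof
        fix e assume e: "e \<in> E"
        obtain u v where uv: "e = (u, v)" by (cases e)
        consider "u \<in> X" "v \<in> Y" | "u \<in> X" "v \<in> L" | "u \<in> Y" | "u \<in> L" "v \<in> X"
          using subsetD[OF edges e] uv by auto
        then show "e \<in> F"
          by cases (use e uv y[of v u] y[of u v] l[of u v] l[of v u] sym F(2) in auto)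
      qed
      then show False using K(3) F(1) by auto
    qed
    then have "card D < card (X \<union> Y)" using sub fin_XY by (intro psubset_card_mono) auto
    then show ?thesis using XY tauc_le[OF D] by simp
  qed
qed

end

section \<open>Chordality and components\<close>

lemma pcas_snoc: "pcas u (p @ [e]) v \<longleftrightarrow> pcas u p (fst e) \<and> snd e = v"
  by (induct p arbitrary: u) auto

lemma pawalk_verts_snoc: "pcas u p w \<Longrightarrow> pawalk_verts u (p @ [(w, x)]) = pawalk_verts u p @ [x]"
  by (induct p arbitrary: u) auto

lemma closed_path_cycle:
  fixes f :: "nat \<Rightarrow> 'a"
  assumes "(c, f 0) \<in> parcs G" "\<And>i. i < n \<Longrightarrow> (f i, f (Suc i)) \<in> parcs G" "(f n, c) \<in> parcs G"
    and "c \<in> pverts G" "inj_on f {..n}" "c \<notin> f ` {..n}"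
  shows "pre_digraph.cycle (with_proj G)
    ((c, f 0) # map (\<lambda>i. (f i, f (Suc i))) [0..<n] @ [(f n, c)])"
proof -
  define q where "q n = map (\<lambda>i. (f i, f (Suc i))) [0..<n]" for n
  have cas: "pcas (f 0) (q k) (f k)" for k
    by (induct k) (auto simp: q_def pcas_snoc)
  have verts: "pawalk_verts (f 0) (q k) = map f [0..<Suc k]" for k
  proof (induct k)
    case (Suc k)
    have "q (Suc k) = q k @ [(f k, f (Suc k))]" by (simp add: q_def)
    then show ?case using Suc pawalk_verts_snoc[OF cas[of k]] by simp
  qed (simp add: q_def)
  have "distinct (map f [0..<Suc n])"
    using assms(5) unfolding distinct_map set_upt atLeast0LessThan lessThan_Suc_atMost by simp
  moreover have "c \<notin> set (map f [0..<Suc n])"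
    using assms(6) unfolding set_map set_upt atLeast0LessThan lessThan_Suc_atMost .
  \<comment> \<open>\<open>tl\<close> drops the initial \<open>c\<close>, so the base point is
    counted once, at the end of the closed walk.\<close>
  ultimately have "distinct (tl (pawalk_verts c ((c, f 0) # q n @ [(f n, c)])))"
    using pawalk_verts_snoc[OF cas[of n]] verts[of n] by auto
  moreover have "pcas c ((c, f 0) # q n @ [(f n, c)]) c" using cas[of n] by (simp add: pcas_snoc)
  moreover have "set ((c, f 0) # q n @ [(f n, c)]) \<subseteq> parcs G" using assms(1-3) by (auto simp: q_def)
  ultimately have "pre_digraph.cycle (with_proj G) ((c, f 0) # q n @ [(f n, c)])"
    using assms(4) unfolding pre_digraph.cycle_def pre_digraph.awalk_def cas_with_proj_eq
      awalk_verts_with_proj_eq with_proj_simps by blast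
  then show ?thesis by (simp add: q_def)
qed

lemma rtrancl_on_iff: "(a, b) \<in> rtrancl_on U r \<longleftrightarrow> a \<in> U \<and> (a, b) \<in> (r \<inter> U \<times> U)\<^sup>*"
proof
  assume "(a, b) \<in> rtrancl_on U r"
  then have "a \<in> U \<and> b \<in> U \<and> (a, b) \<in> (r \<inter> U \<times> U)\<^sup>*"
    by (induct rule: rtrancl_on_induct) (auto intro: rtrancl_into_rtrancl)
  then show "a \<in> U \<and> (a, b) \<in> (r \<inter> U \<times> U)\<^sup>*" by simp
next
  assume *: "a \<in> U \<and> (a, b) \<in> (r \<inter> U \<times> U)\<^sup>*"
  then have "(a, b) \<in> (r \<inter> U \<times> U)\<^sup>*" by simp
  then show "(a, b) \<in> rtrancl_on U r"
    by (induct rule: rtrancl_induct) (use * in \<open>auto intro: rtrancl_on_into_rtrancl_on\<close>)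
qed

lemma relpow_segment:
  assumes "\<And>i. i < n \<Longrightarrow> (f i, f (Suc i)) \<in> R" "i \<le> j" "j \<le> n"
  shows "(f i, f j) \<in> R ^^ (j - i)"
  unfolding relpow_fun_conv using assms by (intro exI[of _ "\<lambda>k. f (i + k)"]) auto

text \<open>A \<open>k\<close>-step jump along the walk that gains more than \<open>k\<close>
  positions contradicts minimality: \<open>k = 0\<close> gives distinct vertices,
  \<open>k = 1\<close> the absence of chords.\<close>

lemma shortest_path:
  assumes "(a, b) \<in> R ^^ n" "\<And>m. m < n \<Longrightarrow> (a, b) \<notin> R ^^ m"
  obtains f where "f 0 = a" "f n = b" "\<And>i. i < n \<Longrightarrow> (f i, f (Suc i)) \<in> R" "inj_on f {..n}"
    "\<And>i j. i < j \<Longrightarrow> j \<le> n \<Longrightarrow> (f i, f j) \<in> R \<Longrightarrow> j = Suc i"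
proof -
  obtain f where f: "f 0 = a" "f n = b" "\<And>i. i < n \<Longrightarrow> (f i, f (Suc i)) \<in> R"
    using assms(1) unfolding relpow_fun_conv by blast
  have short: "j \<le> i + k" if "i \<le> n" "j \<le> n" "(f i, f j) \<in> R ^^ k" for i j k
  proof (rule ccontr)
    assume "\<not> j \<le> i + k"
    have "(a, f i) \<in> R ^^ i" "(f j, b) \<in> R ^^ (n - j)"
      using relpow_segment[of n f R 0 i] relpow_segment[of n f R j n] f that by auto
    then have "(a, b) \<in> R ^^ (i + k + (n - j))" using that(3) by (blast intro: relpow_trans)
    then show False using assms(2)[of "i + k + (n - j)"] that(2) \<open>\<not> j \<le> i + k\<close> by linarith
  qed
  show thesis
  proof (rule that[OF f])
    have "i = j" if "i \<le> n" "j \<le> n" "f i = f j" for i j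
      using short[of i j 0] short[of j i 0] that by auto
    then show "inj_on f {..n}" by (auto intro: inj_onI)
    show "j = Suc i" if "i < j" "j \<le> n" "(f i, f j) \<in> R" for i j
      using short[of i j 1] that by auto
  qed auto
qed

lemma pair_graph_sgraph: "pair_graph G \<Longrightarrow> sgraph (parcs G)"
proof -
  assume "pair_graph G"
  then interpret pair_graph G .
  show ?thesis by unfold_locales (auto dest: arcs_symmetric no_loops')
qed

lemma pair_graph_parcs: "pair_graph G \<Longrightarrow> parcs G \<subseteq> pverts G \<times> pverts G"
proof -
  assume "pair_graph G"
  then interpret pair_graph G .
  show ?thesis by (auto dest: in_arcsD1 in_arcsD2)
qed

lemma pair_graph_finite: "pair_graph G \<Longrightarrow> finite (pverts G)"
proof -
  assume "pair_graph G"
  then interpret pair_graph G .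
  show ?thesis by (rule pair_finite_verts)
qed

lemma pair_graphI:
  assumes "finite (pverts G)" "sgraph (parcs G)" "parcs G \<subseteq> pverts G \<times> pverts G"
  shows "pair_graph G"
proof -
  interpret sgraph "parcs G" by fact
  have "finite (parcs G)" using assms by (auto intro: finite_subset)
  then show ?thesis
    using assms irr by unfold_locales (auto simp: symmetric_def intro!: symI dest: sym)
qed

text \<open>Induction on the length of a walk from \<open>w\<close> to \<open>w'\<close> in
  \<open>U\<close>. A shortest one closes up through \<open>c\<close> to a cycle; having no chord of
  its own, the path must receive one from \<open>c\<close> at an inner vertex, which splits it into
  two shorter walks between neighbours of \<open>c\<close>.\<close>

lemma chordal_links_connected:
  assumes G: "pair_graph G" "chordal G"
  shows "links_connected (parcs G)"
proof -
  interpret sgraph "parcs G" using G pair_graph_sgraph by blast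
  let ?E = "parcs G"
  have "(w, w') \<in> rtrancl_on (U \<inter> ?E `` {c}) ?E"
    if "c \<notin> U" "(c, w) \<in> ?E" "(c, w') \<in> ?E" "w \<in> U" "(w, w') \<in> (?E \<inter> U \<times> U) ^^ n" for U c w w' n
    using that
  proof (induct n arbitrary: w w' rule: less_induct)
    case (less n)
    let ?R = "?E \<inter> U \<times> U"
    show ?case
    proof (cases "\<exists>m<n. (w, w') \<in> ?R ^^ m")
      case True
      then show ?thesis using less by blast
    next
      case False
      then have short: "\<And>m. m < n \<Longrightarrow> (w, w') \<notin> ?R ^^ m" by blast
      obtain f where f: "f 0 = w" "f n = w'" "\<And>i. i < n \<Longrightarrow> (f i, f (Suc i)) \<in> ?R" "inj_on f {..n}"
        "\<And>i j. i < j \<Longrightarrow> j \<le> n \<Longrightarrow> (f i, f j) \<in> ?R \<Longrightarrow> j = Suc i"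
        using shortest_path[OF less.prems(5) short] by metis
      consider "n = 0" | "n = 1" | "n \<ge> 2" by linarith
      then show ?thesis
      proof cases
        case 1
        then show ?thesis using less.prems by auto
      next
        case 2
        then show ?thesis using less.prems by (auto intro!: rtrancl_on_edge)
      next
        case 3
        have fU: "f i \<in> U" if "i \<le> n" for i
        proof (cases "i = n")
          case True
          then show ?thesis using f(3)[of "n - 1"] 3 by auto
        next
          case False
          then show ?thesis using f(3)[of i] that by auto
        qed
        have cf: "c \<notin> f ` {..n}" using fU less.prems(1) by auto
        define p where "p = (c, f 0) # map (\<lambda>i. (f i, f (Suc i))) [0..<n] @ [(f n, c)]"
        have "pre_digraph.cycle (with_proj G) p"
          unfolding p_def
        proof (rule closed_path_cycle)
          show "c \<in> pverts G" using less.prems(2) pair_graph_parcs[OF G(1)] by auto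
        qed (use f less.prems cf in \<open>auto intro: sym\<close>)
        \<comment> \<open>The cycle has \<open>n + 2\<close> arcs; for \<open>n = 1\<close> it would
          be a triangle, hence the separate treatment of small \<open>n\<close>.\<close>
        moreover have "length p \<ge> 4" using 3 by (simp add: p_def)
        ultimately obtain x y where xy: "(x, y) \<in> ?E" "x \<in> fst ` set p" "y \<in> fst ` set p"
          "(x, y) \<notin> set p" "(y, x) \<notin> set p"
          using G(2) unfolding chordal_def by blast
        have setp: "set p = insert (c, f 0) (insert (f n, c) ((\<lambda>i. (f i, f (Suc i))) ` {..<n}))"
          by (auto simp: p_def)
        have "fst ` set p \<subseteq> insert c (f ` {..n})" by (auto simp: setp)
        then have xy': "x \<in> insert c (f ` {..n})" "y \<in> insert c (f ` {..n})" using xy by auto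
        have no: False if "i < j" "j \<le> n" "(f i, f j) \<in> ?E" "(f i, f j) \<notin> set p" for i j
        proof -
          have "(f i, f j) \<in> ?R" using that fU by auto
          then have "j = Suc i" using f(5)[OF that(1,2)] by blast
          then show False using that by (auto simp: setp)
        qed
        have "x = c \<or> y = c"
        proof (rule ccontr)
          assume "\<not> (x = c \<or> y = c)"
          then obtain i j where ij: "i \<le> n" "j \<le> n" "x = f i" "y = f j" using xy' by auto
          consider "i < j" | "j < i" | "i = j" by linarith
          then show False
            by cases (use no[of i j] no[of j i] xy ij sym[OF xy(1)] irr in auto)
        qed
        then obtain i where i: "i \<le> n" "(c, f i) \<in> ?E" "(c, f i) \<notin> set p" "(f i, c) \<notin> set p"
          using xy xy' sym[OF xy(1)] irr by auto
        have "i \<noteq> 0" "i \<noteq> n" using i by (auto simp: setp)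
        then have i': "i < n" "n - i < n" using i by auto
        have "(w, f i) \<in> ?R ^^ i" "(f i, w') \<in> ?R ^^ (n - i)"
          using relpow_segment[of n f ?R 0 i] relpow_segment[of n f ?R i n] f(1-3) i by auto
        then have "(w, f i) \<in> rch (U \<inter> ?E `` {c})" "(f i, w') \<in> rch (U \<inter> ?E `` {c})"
          using less.hyps[OF i'(1), of w "f i"] less.hyps[OF i'(2), of "f i" w'] less.prems i fU by auto
        then show ?thesis by (rule rtrancl_on_trans)
      qed
    qed
  qed
  then show ?thesis
    unfolding links_connected_def rtrancl_on_iff[of _ _ _ ?E] by (metis rtrancl_imp_relpow)
qed

section \<open>Components and sums over the nontrivial ones\<close>

definition comps :: "('a \<times> 'a) set \<Rightarrow> 'a set \<Rightarrow> 'a set set" where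
  "comps E U = (\<lambda>u. {v. (u, v) \<in> rtrancl_on U E}) ` U"

definition edge_comps :: "('a \<times> 'a) set \<Rightarrow> 'a set \<Rightarrow> 'a set set" where
  "edge_comps E U = {K \<in> comps E U. \<exists>(u, v) \<in> E. u \<in> K \<and> v \<in> K}"

lemma rtrancl_on_restrict: "rtrancl_on U (r \<inter> U \<times> U) = rtrancl_on U r"
  by (auto simp: rtrancl_on_iff Int_assoc)

lemma conn_restrict: "C \<subseteq> U \<Longrightarrow> conn (E \<inter> U \<times> U) C \<longleftrightarrow> conn E C"
proof -
  assume "C \<subseteq> U"
  then have "E \<inter> U \<times> U \<inter> C \<times> C = E \<inter> C \<times> C" by auto
  then show ?thesis using rtrancl_on_restrict[of C "E \<inter> U \<times> U"] rtrancl_on_restrict[of C E]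
    by (simp add: conn_def)
qed

lemma covers_restrict: "covers (E \<inter> U \<times> U) U C \<longleftrightarrow> covers E U C"
  by (auto simp: covers_def)

lemma tau_restrict: "tau (E \<inter> U \<times> U) U = tau E U"
  by (simp add: tau_def covers_restrict)

lemma tauc_restrict: "tauc (E \<inter> U \<times> U) U = tauc E U"
proof -
  have "covers (E \<inter> U \<times> U) U C \<and> conn (E \<inter> U \<times> U) C \<longleftrightarrow> covers E U C \<and> conn E C" for C
    using conn_restrict[of C U E] by (auto simp: covers_restrict) (auto simp: covers_def)
  then show ?thesis by (simp add: tauc_def)
qed

context sgraph
begin

lemma comps_conn: "K \<in> comps E U \<Longrightarrow> conn E K \<and> K \<subseteq> U"
  unfolding comps_def using conn_reach_set(1,3) by blast

lemma comps_eq: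
  assumes "K \<in> comps E U" "u \<in> K"
  shows "K = {v. (u, v) \<in> rch U}"
proof -
  obtain w where w: "K = {v. (w, v) \<in> rch U}" using assms by (auto simp: comps_def)
  then have "(w, u) \<in> rch U" using assms by simp
  then have "(w, v) \<in> rch U \<longleftrightarrow> (u, v) \<in> rch U" for v
    using rtrancl_on_trans[of w u U E v] rtrancl_on_trans[of u w U E v] rch_sym[of w u U] by blast
  then show ?thesis unfolding w by simp
qed

lemma comps_disjoint: "K \<in> comps E U \<Longrightarrow> K' \<in> comps E U \<Longrightarrow> K \<noteq> K' \<Longrightarrow> K \<inter> K' = {}"
  by (metis comps_eq disjoint_iff)

lemma finite_comps: "finite U \<Longrightarrow> finite (comps E U)"
  by (simp add: comps_def)

lemma edge_in_edge_comps:
  assumes "(u, v) \<in> E" "u \<in> U" "v \<in> U"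
  obtains K where "K \<in> edge_comps E U" "u \<in> K" "v \<in> K"
proof
  let ?K = "{v. (u, v) \<in> rch U}"
  show "u \<in> ?K" "v \<in> ?K" using assms by (auto intro: rtrancl_on_edge)
  then show "?K \<in> edge_comps E U" using assms by (auto simp: edge_comps_def comps_def)
qed

lemma sum_tau_le:
  assumes "finite U"
  shows "(\<Sum>K\<in>edge_comps E U. tau E K) \<le> tau E U"
proof -
  obtain C where C: "covers E U C" "card C = tau E U" by (rule tau_attained)
  have finC: "finite C" using C assms by (auto simp: covers_def intro: finite_subset)
  have "(\<Sum>K\<in>edge_comps E U. tau E K) \<le> (\<Sum>K\<in>edge_comps E U. card (C \<inter> K))"
  proof (intro sum_mono tau_le)
    fix K assume "K \<in> edge_comps E U"
    then have "K \<subseteq> U" using comps_conn by (auto simp: edge_comps_def)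
    then show "covers E K (C \<inter> K)" using C(1) unfolding covers_def by blast
  qed
  also have "\<dots> = card (\<Union>K\<in>edge_comps E U. C \<inter> K)"
    by (rule card_UN_disjoint[symmetric])
      (use finC finite_comps[OF assms] comps_disjoint in \<open>auto simp: edge_comps_def\<close>)
  also have "\<dots> \<le> card C" using finC by (intro card_mono) auto
  finally show ?thesis using C by simp
qed

text \<open>Optimal connected covers of the nontrivial components do not interact, so their union
  has exactly one component for each. This yields only an upper bound for the connected cover
  number, which is the direction needed.\<close>

lemma union_of_connected_covers:
  assumes "finite U"
  obtains Z where "covers E U Z" "card Z = (\<Sum>K\<in>edge_comps E U. tauc E K)"
    "card (comps E Z) = card (edge_comps E U)"
proof -
  let ?N = "edge_comps E U"
  have N: "K \<in> comps E U" if "K \<in> ?N" for K using that by (simp add: edge_comps_def)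
  have "\<exists>C. covers E K C \<and> conn E C \<and> card C = tauc E K" if "K \<in> ?N" for K
    using tauc_attained comps_conn N that by metis
  then obtain f where f: "covers E K (f K)" "conn E (f K)" "card (f K) = tauc E K" if "K \<in> ?N" for K
    by metis
  define Z where "Z = (\<Union>K\<in>?N. f K)"
  have fK: "f K \<subseteq> K" "f K \<noteq> {}" if "K \<in> ?N" for K
    using f that by (auto simp: covers_def conn_def)
  have finN: "finite ?N" using finite_comps[OF assms] by (simp add: edge_comps_def)
  have finf: "finite (f K)" if "K \<in> ?N" for K
    by (rule finite_subset[OF order_trans[OF fK(1)[OF that] conjunct2[OF comps_conn[OF N[OF that]]]] assms])
  have disj: "f K \<inter> f K' = {}" if "K \<in> ?N" "K' \<in> ?N" "K \<noteq> K'" for K K'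
    using comps_disjoint[OF N[OF that(1)] N[OF that(2)] that(3)] fK(1)[OF that(1)] fK(1)[OF that(2)] by blast
  show thesis
  proof
    have KU: "K \<subseteq> U" if "K \<in> ?N" for K using comps_conn[OF N[OF that]] by simp
    then have "Z \<subseteq> U" using fK(1) unfolding Z_def by blast
    moreover have "u \<in> Z \<or> v \<in> Z" if uv: "u \<in> U" "v \<in> U" "(u, v) \<in> E" for u v
    proof -
      obtain K where "K \<in> ?N" "u \<in> K" "v \<in> K" using edge_in_edge_comps uv by metis
      then have "u \<in> f K \<or> v \<in> f K" using f(1)[of K] uv(3) unfolding covers_def by blast
      then show ?thesis using \<open>K \<in> ?N\<close> by (auto simp: Z_def)
    qed
    ultimately show "covers E U Z" by (auto simp: covers_def)
    have "card Z = (\<Sum>K\<in>?N. card (f K))"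
      unfolding Z_def by (rule card_UN_disjoint) (use finN finf disj in auto)
    then show "card Z = (\<Sum>K\<in>?N. tauc E K)" using f(3) by simp
    \<comment> \<open>A step inside \<open>Z\<close> stays in the component \<open>K\<close>, and
      \<open>f K\<close> is all that \<open>Z\<close> contains of \<open>K\<close>.\<close>
    have cl: "{v. (u, v) \<in> rch Z} = f K" if K: "K \<in> ?N" and u: "u \<in> f K" for u K
    proof
      have "f K \<subseteq> Z" using K by (auto simp: Z_def)
      then show "f K \<subseteq> {v. (u, v) \<in> rch Z}"
        using f(2)[OF K] u rtrancl_on_subset[of "f K" Z] by (auto simp: conn_def)
      show "{v. (u, v) \<in> rch Z} \<subseteq> f K"
      proof safe
        fix v assume "(u, v) \<in> rch Z"
        then show "v \<in> f K"
        proof (induct rule: rtrancl_on_induct)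
          case base
          then show ?case using u by simp
        next
          case (step y z)
          obtain K' where K': "K' \<in> ?N" "z \<in> f K'" using step by (auto simp: Z_def)
          have y: "y \<in> K" using step fK(1)[OF K] by auto
          have "z \<in> U" using K' fK(1) KU by blast
          moreover have "y \<in> U" using y KU[OF K] by auto
          ultimately have "z \<in> K" using comps_eq[OF N[OF K] y] step by (auto intro: rtrancl_on_edge)
          then have "K = K'" using comps_disjoint[OF N[OF K] N[OF K'(1)]] K' fK(1)[OF K'(1)] by blast
          then show ?case using K' by simp
        qed
      qed
    qed
    have "comps E Z = f ` ?N"
    proof
      show "comps E Z \<subseteq> f ` ?N" using cl by (auto simp: comps_def Z_def)
      show "f ` ?N \<subseteq> comps E Z"
      proof
        fix A assume "A \<in> f ` ?N"
        then obtain K where K: "K \<in> ?N" "A = f K" by auto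
        then obtain u where u: "u \<in> f K" using fK by blast
        then have "u \<in> Z" using K by (auto simp: Z_def)
        then show "A \<in> comps E Z" using cl[OF K(1) u] K unfolding comps_def by blast
      qed
    qed
    moreover have "inj_on f ?N" using disj fK(2) unfolding inj_on_def by (metis inf.idem)
    ultimately show "card (comps E Z) = card ?N" by (simp add: card_image)
  qed
qed

lemma comps_connected: "conn E U \<Longrightarrow> comps E U = {U}"
  unfolding comps_def conn_def by (auto dest: in_rtrancl_on_in_F)

end

section \<open>The price of connectivity\<close>

lemma arcs_ends_induce: "arcs_ends (with_proj G \<restriction> C) = parcs G \<inter> C \<times> C"
  by (auto simp: arcs_ends_conv induce_subgraph_def with_proj_def image_iff)

text \<open>Library connectivity refers to the symmetric closure of the arcs, which changes nothing
  here.\<close>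

lemma symcl_restrict:
  assumes "sgraph E" shows "symcl (E \<inter> U \<times> U) = E \<inter> U \<times> U"
  using sgraph.sym[OF assms] by (auto simp: symcl_def)

lemma connected_induce_iff:
  assumes "pair_graph G"
  shows "Digraph_Component.connected (with_proj G \<restriction> C) \<longleftrightarrow> conn (parcs G) C"
  using symcl_restrict[OF pair_graph_sgraph[OF assms], of C]
  by (simp add: connected_conv arcs_ends_induce conn_def rtrancl_on_restrict)

lemma connected_iff:
  assumes "pair_graph G"
  shows "Digraph_Component.connected (with_proj G) \<longleftrightarrow> conn (parcs G) (pverts G)"
proof -
  have "parcs G \<inter> pverts G \<times> pverts G = parcs G" using pair_graph_parcs[OF assms] by auto
  then show ?thesis using symcl_restrict[OF pair_graph_sgraph[OF assms], of "pverts G"]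
    by (simp add: connected_conv conn_def)
qed

lemma vertex_cover_iff: "pair_graph G \<Longrightarrow> vertex_cover G C \<longleftrightarrow> covers (parcs G) (pverts G) C"
  using pair_graph_parcs[of G] by (auto simp: vertex_cover_def covers_def)

lemma vertex_cover_number_eq: "pair_graph G \<Longrightarrow> vertex_cover_number G = tau (parcs G) (pverts G)"
  by (simp add: vertex_cover_number_def tau_def vertex_cover_iff)

lemma connected_vertex_cover_number_eq:
  assumes "pair_graph G" "conn (parcs G) (pverts G)"
  shows "connected_vertex_cover_number G = tauc (parcs G) (pverts G)"
  using assms by (simp add: connected_vertex_cover_number_def tauc_def connected_vertex_cover_def
      vertex_cover_iff connected_iff connected_induce_iff)

text \<open>With symmetric arcs, reachability is already mutual. \<open>H\<close> is arbitrary so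
  that the statement serves the whole graph and the subgraphs induced by covers.\<close>

lemma (in sgraph) sccs_verts_eq_comps:
  assumes "\<And>u v. reachable H u v \<longleftrightarrow> (u, v) \<in> rch U"
  shows "pre_digraph.sccs_verts H = comps E U"
proof
  show "pre_digraph.sccs_verts H \<subseteq> comps E U"
  proof
    fix S assume S: "S \<in> pre_digraph.sccs_verts H"
    then obtain u where u: "u \<in> S" by (auto simp: pre_digraph.sccs_verts_def)
    have in_S: "(x, y) \<in> rch U" if "x \<in> S" "y \<in> S" for x y
      using S that by (auto simp: pre_digraph.sccs_verts_def assms)
    have out_S: "y \<in> S" if "x \<in> S" "(x, y) \<in> rch U" for x y
      using S that rch_sym[OF that(2)] by (auto simp: pre_digraph.sccs_verts_def assms)
    have "S = {v. (u, v) \<in> rch U}" using in_S out_S u by blast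
    moreover have "u \<in> U" using in_S[OF u u] by (auto dest: in_rtrancl_on_in_F)
    ultimately show "S \<in> comps E U" by (auto simp: comps_def)
  qed
  show "comps E U \<subseteq> pre_digraph.sccs_verts H"
  proof
    fix S assume S: "S \<in> comps E U"
    have eq: "(x, v) \<in> rch U \<longleftrightarrow> v \<in> S" if "x \<in> S" for x v using comps_eq[OF S that] by auto
    have "S \<noteq> {}" using S by (auto simp: comps_def)
    then show "S \<in> pre_digraph.sccs_verts H"
      unfolding pre_digraph.sccs_verts_def assms using eq by simp
  qed
qed

lemma nontrivial_components_eq:
  assumes "pair_graph G"
  shows "nontrivial_components G = edge_comps (parcs G) (pverts G)"
proof -
  interpret sgraph "parcs G" using pair_graph_sgraph[OF assms] .
  have "pre_digraph.sccs_verts (with_proj G) = comps (parcs G) (pverts G)"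
    by (rule sccs_verts_eq_comps) (simp add: reachable_def)
  then show ?thesis by (simp add: nontrivial_components_def edge_comps_def)
qed

lemma sccs_verts_induce:
  assumes "pair_graph G"
  shows "pre_digraph.sccs_verts (with_proj G \<restriction> C) = comps (parcs G) C"
proof -
  interpret sgraph "parcs G" using pair_graph_sgraph[OF assms] .
  show ?thesis
    by (rule sccs_verts_eq_comps) (simp add: reachable_def arcs_ends_induce rtrancl_on_restrict)
qed

lemma connected_vertex_cover_number_le_sum:
  assumes G: "pair_graph G" "parcs G \<noteq> {}"
  shows "connected_vertex_cover_number G \<le> (\<Sum>K\<in>edge_comps (parcs G) (pverts G). tauc (parcs G) K)"
proof -
  interpret sgraph "parcs G" using pair_graph_sgraph[OF G(1)] .
  show ?thesis
  proof (cases "conn (parcs G) (pverts G)")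
    case True
    have "edge_comps (parcs G) (pverts G) = {pverts G}"
      using comps_connected[OF True] G(2) pair_graph_parcs[OF G(1)] by (auto simp: edge_comps_def)
    then show ?thesis using connected_vertex_cover_number_eq[OF G(1) True] by simp
  next
    case False
    obtain Z where Z: "covers (parcs G) (pverts G) Z"
      "card Z = (\<Sum>K\<in>edge_comps (parcs G) (pverts G). tauc (parcs G) K)"
      "card (comps (parcs G) Z) = card (edge_comps (parcs G) (pverts G))"
      using union_of_connected_covers[OF pair_graph_finite[OF G(1)]] .
    have "connected_vertex_cover G Z"
      using Z(1,3) False by (simp add: connected_vertex_cover_def vertex_cover_iff[OF G(1)]
          connected_iff[OF G(1)] sccs_verts_induce[OF G(1)] nontrivial_components_eq[OF G(1)])
    then have "connected_vertex_cover_number G \<le> card Z"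
      unfolding connected_vertex_cover_number_def by (intro Least_le) blast
    then show ?thesis using Z(2) by simp
  qed
qed

section \<open>From criticality to the local structure\<close>

lemma induced_pair_graph:
  assumes G: "pair_graph G" and U: "U \<subseteq> pverts G"
  defines "H \<equiv> \<lparr>pverts = U, parcs = parcs G \<inter> U \<times> U\<rparr>"
  shows "pair_graph H" "induced_subgraph (with_proj H) (with_proj G)"
proof -
  have s: "sgraph (parcs G)" using pair_graph_sgraph[OF G] .
  show H: "pair_graph H"
  proof (rule pair_graphI)
    show "finite (pverts H)" using finite_subset[OF U pair_graph_finite[OF G]] by (simp add: H_def)
    show "sgraph (parcs H)"
      by unfold_locales (auto simp: H_def intro: sgraph.sym[OF s] dest: sgraph.irr[OF s, THEN notE])
  qed (auto simp: H_def)
  have "wf_digraph (with_proj G)" "wf_digraph (with_proj H)"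
    using G H by (auto simp: wf_digraph_wp_iff pair_graph_def pair_digraph_def pair_fin_digraph_def)
  then show "induced_subgraph (with_proj H) (with_proj G)"
    using U by (auto simp: induced_subgraph_def subgraph_def compatible_def H_def)
qed

text \<open>\<open>G\<close> is not yet known to be connected, so its connected cover number cannot
  be written as a \<open>tauc\<close> here; \<open>critical_connected\<close> depends on this
  form.\<close>

lemma critical_bound:
  assumes G: "pair_graph G" "critical G" and U: "U \<subset> pverts G" "conn (parcs G) U"
    and uv: "u \<in> U" "v \<in> U" "(u, v) \<in> parcs G"
  shows "tauc (parcs G) U * tau (parcs G) (pverts G) < connected_vertex_cover_number G * tau (parcs G) U"
proof -
  let ?H = "\<lparr>pverts = U, parcs = parcs G \<inter> U \<times> U\<rparr>"
  have H: "pair_graph ?H" "induced_subgraph (with_proj ?H) (with_proj G)"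
    using induced_pair_graph[OF G(1)] U by auto
  have "?H \<noteq> G" using U(1) by (metis pair_pre_digraph.select_convs(1) psubset_eq)
  moreover have "parcs ?H \<noteq> {}" using uv by auto
  ultimately have "PoC ?H < PoC G" using G(2) H unfolding critical_def by blast
  moreover have "conn (parcs ?H) (pverts ?H)" using U(2) conn_restrict[of U U] by simp
  ultimately have "real (tauc (parcs G) U) / real (tau (parcs G) U)
    < real (connected_vertex_cover_number G) / real (tau (parcs G) (pverts G))"
    using connected_vertex_cover_number_eq[OF H(1)]
    by (simp add: PoC_def vertex_cover_number_eq[OF G(1)] vertex_cover_number_eq[OF H(1)] tau_restrict tauc_restrict)
  moreover have "0 < tau (parcs G) U" "0 < tau (parcs G) (pverts G)"
  proof -
    have UV: "U \<subseteq> pverts G" using U(1) by blast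
    have "finite U" by (rule finite_subset[OF UV pair_graph_finite[OF G(1)]])
    then show "0 < tau (parcs G) U" by (rule tau_pos[OF _ uv])
    show "0 < tau (parcs G) (pverts G)"
      by (rule tau_pos[OF pair_graph_finite[OF G(1)] _ _ uv(3)]) (use UV uv in auto)
  qed
  ultimately have "real (tauc (parcs G) U) * real (tau (parcs G) (pverts G))
    < real (connected_vertex_cover_number G) * real (tau (parcs G) U)"
    by (simp add: divide_simps mult.commute split: if_splits)
  then show ?thesis by (simp only: of_nat_mult[symmetric] of_nat_less_iff)
qed

text \<open>A mediant argument: each nontrivial component is a proper induced subgraph and so has a
  smaller ratio, yet the sums of \<open>tauc\<close> and \<open>tau\<close> over these components
  have a ratio at least that of \<open>G\<close>. Isolated vertices are excluded in the same
  way.\<close>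

lemma critical_connected:
  assumes G: "pair_graph G" "critical G"
  shows "conn (parcs G) (pverts G)"
proof (rule ccontr)
  assume nc: "\<not> conn (parcs G) (pverts G)"
  interpret sgraph "parcs G" using pair_graph_sgraph[OF G(1)] .
  let ?E = "parcs G" and ?V = "pverts G"
  let ?N = "edge_comps ?E ?V"
  have fin: "finite ?N" using finite_comps[OF pair_graph_finite[OF G(1)]] by (simp add: edge_comps_def)
  obtain p q where "(p, q) \<in> ?E" using G(2) by (auto simp: critical_def)
  then have ne: "?N \<noteq> {}"
    using edge_in_edge_comps[of p q ?V] pair_graph_parcs[OF G(1)] by blast
  have "tauc ?E K * tau ?E ?V < connected_vertex_cover_number G * tau ?E K" if K: "K \<in> ?N" for K
  proof -
    have "K \<in> comps ?E ?V" using K by (simp add: edge_comps_def)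
    then have c: "conn ?E K" "K \<subseteq> ?V" using comps_conn by auto
    moreover have "K \<noteq> ?V" using c(1) nc by auto
    moreover obtain u v where "u \<in> K" "v \<in> K" "(u, v) \<in> ?E" using K by (auto simp: edge_comps_def)
    ultimately show ?thesis using critical_bound[OF G, of K] by blast
  qed
  then have "(\<Sum>K\<in>?N. tauc ?E K * tau ?E ?V) < (\<Sum>K\<in>?N. connected_vertex_cover_number G * tau ?E K)"
    by (intro sum_strict_mono fin ne)
  then have "(\<Sum>K\<in>?N. tauc ?E K) * tau ?E ?V < connected_vertex_cover_number G * (\<Sum>K\<in>?N. tau ?E K)"
    by (simp add: sum_distrib_left sum_distrib_right)
  also have "\<dots> \<le> connected_vertex_cover_number G * tau ?E ?V"
    using sum_tau_le[OF pair_graph_finite[OF G(1)]] by simp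
  also have "\<dots> \<le> (\<Sum>K\<in>?N. tauc ?E K) * tau ?E ?V"
    using connected_vertex_cover_number_le_sum[OF G(1)] G(2) by (intro mult_le_mono1) (simp add: critical_def)
  finally show False by simp
qed

lemma critical_chordal_special_structure:
  assumes G: "pair_graph G" "chordal G" "critical G"
  shows "\<exists>X Y L. special_structure (parcs G) (pverts G) X Y L"
proof -
  let ?E = "parcs G" and ?V = "pverts G"
  interpret sgraph ?E using pair_graph_sgraph[OF G(1)] .
  have EV: "?E \<subseteq> ?V \<times> ?V" using pair_graph_parcs[OF G(1)] .
  have conn: "conn ?E ?V" using critical_connected G by blast
  have fin: "finite ?V" using pair_graph_finite[OF G(1)] .
  show ?thesis
  proof (cases "\<exists>a b. ?V = {a, b}")
    case True
    then obtain a b where V: "?V = {a, b}" by auto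
    obtain p q where pq: "(p, q) \<in> ?E" using G(3) by (auto simp: critical_def)
    then have "p \<in> {a, b}" "q \<in> {a, b}" "p \<noteq> q" using EV V irr by auto
    then have ab: "a \<noteq> b" "(a, b) \<in> ?E" "(b, a) \<in> ?E" using pq sym[OF pq] by auto
    have E: "?E = {(a, b), (b, a)}" using ab EV V irr by auto
    \<comment> \<open>The single edge comes from the one-vertex tree: one old vertex with its
      pendant vertex.\<close>
    have "special_structure ?E ?V {a} {} {b}"
    proof unfold_locales
      show "\<exists>x. ?E `` {l} = {x}" if "l \<in> {b}" for l using that E ab by auto
      show "if \<exists>y\<in>{}. \<exists>y'\<in>{}. y \<noteq> y' \<and> (x, y) \<in> ?E \<and> (x, y') \<in> ?E
        then ?E `` {x} \<inter> {b} = {} else \<exists>l. ?E `` {x} \<inter> {b} = {l}" if "x \<in> {a}" for x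
        using that E ab by auto
    qed (use V E ab conn fin in auto)
    then show ?thesis by blast
  next
    case False
    have "critical_chordal ?E ?V"
    proof unfold_locales
      fix U assume U: "U \<subset> ?V" "conn ?E U" "\<forall>s. U \<noteq> {s}"
      obtain u where u: "u \<in> U" using U by (auto simp: conn_def)
      obtain v where "v \<in> U" "(u, v) \<in> ?E" using conn_neighbour[OF U(2) u] U(3) by blast
      then show "tauc ?E U * tau ?E ?V < tauc ?E ?V * tau ?E U"
        using critical_bound[OF G(1,3) U(1,2) u] connected_vertex_cover_number_eq[OF G(1) conn] by simp
    qed (use False EV conn fin chordal_links_connected[OF G(1,2)] in auto)
    then show ?thesis by (rule critical_chordal.special_structure_exists)
  qed
qed

text \<open>With \<open>n = card X\<close> and \<open>m = card Y\<close>, the ratio of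
  \<open>G\<close> is at least \<open>(n + m) / n\<close> and that of \<open>H\<close> at most
  \<open>s / tau ?F ?W\<close>; \<open>key\<close> compares these bounds after
  cross-multiplication.\<close>

lemma special_structure_strongly_critical:
  assumes G: "pair_graph G" "special_structure (parcs G) (pverts G) X Y L" "parcs G \<noteq> {}"
  shows "strongly_critical G"
  unfolding strongly_critical_def
proof (intro conjI allI impI G(3))
  fix H :: "'a pair_pre_digraph"
  let ?E = "parcs G" and ?V = "pverts G" and ?F = "parcs H" and ?W = "pverts H"
  interpret S: special_structure ?E ?V X Y L by fact
  assume H: "pair_graph H \<and> subgraph (with_proj H) (with_proj G) \<and> H \<noteq> G \<and> ?F \<noteq> {}"
  then have pH: "pair_graph H" and WV: "?W \<subseteq> ?V" and FE: "?F \<subseteq> ?E" and Fne: "?F \<noteq> {}"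
    by (auto simp: subgraph_def)
  have FW: "?F \<subseteq> ?W \<times> ?W" using pair_graph_parcs[OF pH] .
  interpret F: sgraph ?F using pair_graph_sgraph[OF pH] .
  have neq: "?F \<noteq> ?E"
  proof
    assume eq: "?F = ?E"
    have "?V \<subseteq> ?W"
    proof
      fix v assume v: "v \<in> ?V"
      obtain u where "(v, u) \<in> ?E" using conn_neighbour[OF S.conn v S.no_singleton[OF G(3)]] .
      then show "v \<in> ?W" using eq FW by auto
    qed
    then show False using eq WV H by auto
  qed
  let ?N = "edge_comps ?F ?W"
  define n where "n = card X"
  define m where "m = card Y"
  define k where "k = card ?N"
  define t where "t = (\<Sum>K\<in>?N. tau ?F K)"
  define s where "s = (\<Sum>K\<in>?N. tauc ?F K)"
  have finW: "finite ?W" using pair_graph_finite[OF pH] .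
  have fin: "finite ?N" using F.finite_comps[OF finW] by (simp add: edge_comps_def)
  obtain p q where "(p, q) \<in> ?F" using Fne by auto
  then have ne: "?N \<noteq> {}" using F.edge_in_edge_comps[of p q ?W] FW by blast
  have K: "K \<subseteq> ?W" "conn ?F K" "finite K" "\<exists>u v. u \<in> K \<and> v \<in> K \<and> (u, v) \<in> ?F" if "K \<in> ?N" for K
    using F.comps_conn[of K ?W] that finW by (auto simp: edge_comps_def intro: finite_subset)
  have k: "0 < k" using fin ne by (simp add: k_def card_gt_0_iff)
  \<comment> \<open>Every nontrivial component contributes its own saving of one.\<close>
  have "(\<Sum>K\<in>?N. tauc ?F K) + (\<Sum>K\<in>?N. 1) \<le> (\<Sum>K\<in>?N. 2 * tau ?F K)"
    unfolding sum.distrib[symmetric] by (rule sum_mono) (use K F.tauc_le_two_tau in blast)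
  then have st: "s + k \<le> 2 * t" by (simp add: s_def t_def k_def sum_distrib_left)
  have tW: "t \<le> tau ?F ?W" unfolding t_def by (rule F.sum_tau_le[OF finW])
  have Wn: "tau ?F ?W \<le> n" using S.tau_le_card_X[OF WV FE] by (simp add: n_def)
  have nm: "n \<le> m + 1" using S.card_X_le[OF S.X_nonempty[OF G(3)]] by (simp add: n_def m_def)
  have one: "s < n + m" if "k = 1"
  proof -
    obtain K0 where K0: "?N = {K0}" using \<open>k = 1\<close> unfolding k_def by (rule card_1_singletonE)
    have "tauc ?F K0 < card X + card Y"
    proof (rule S.subgraph_tauc_less[OF FE _ Fne _ _ neq])
      show "(v, u) \<in> ?F" if "(u, v) \<in> ?F" for u v using that by (rule F.sym)
      show "K0 \<subseteq> ?V" "conn ?F K0" using K[of K0] K0 WV by auto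
    qed
    then show ?thesis using K0 by (simp add: s_def n_def m_def)
  qed
  have key: "s * n < (n + m) * tau ?F ?W"
  proof (cases "k = 1 \<and> t = n")
    case True
    then have "s * n < (n + m) * n" using one st by (intro mult_strict_right_mono) auto
    then show ?thesis using True tW Wn by simp
  next
    case False
    \<comment> \<open>This is false precisely in the case treated before. From it,
      \<open>s + k\<close> \<le> \<open>2 * t\<close> gives \<open>s * n < (2 * n - 1) * t\<close>,
      and \<open>2 * n - 1\<close> \<le> \<open>n + m\<close>.\<close>
    have "t < k * n"
    proof (cases "k = 1")
      case True
      then show ?thesis using False tW Wn by simp
    next
      case False
      then have "n < k * n \<or> n = 0" using k by auto
      moreover have "n \<noteq> 0" using st k tW Wn by auto
      ultimately show ?thesis using tW Wn by linarith
    qed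
    moreover have "(s + k) * n \<le> 2 * t * n" using st by (rule mult_le_mono1)
    ultimately have "s * n + t < 2 * n * t" by (simp add: algebra_simps)
    moreover have "(2 * n) * t \<le> (n + m + 1) * t" using nm by (intro mult_le_mono1) simp
    ultimately have "s * n < (n + m) * t" by (simp add: algebra_simps)
    also have "\<dots> \<le> (n + m) * tau ?F ?W" using tW by simp
    finally show ?thesis .
  qed
  have pos: "0 < tau ?F ?W" "0 < tau ?E ?V"
    using tau_pos[OF finW _ _ \<open>(p, q) \<in> ?F\<close>] tau_pos[OF S.fin, of p q ?E] \<open>(p, q) \<in> ?F\<close> FE FW S.EV by auto
  have "connected_vertex_cover_number H * tau ?E ?V \<le> s * n"
    using connected_vertex_cover_number_le_sum[OF pH Fne] S.tau_le_card_X[OF order_refl order_refl]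
    by (intro mult_le_mono) (simp_all add: s_def n_def)
  also have "\<dots> < (n + m) * tau ?F ?W" by (rule key)
  also have "\<dots> \<le> tauc ?E ?V * tau ?F ?W"
    using S.card_XY_le_tauc[OF G(3)] by (intro mult_le_mono1) (simp add: n_def m_def)
  finally have "real (connected_vertex_cover_number H * tau ?E ?V) < real (tauc ?E ?V * tau ?F ?W)"
    by (simp only: of_nat_less_iff)
  then show "PoC H < PoC G"
    using pos by (simp add: PoC_def vertex_cover_number_eq[OF G(1)] vertex_cover_number_eq[OF pH]
        connected_vertex_cover_number_eq[OF G(1) S.conn] divide_simps mult.commute)
qed

lemma strongly_critical_imp_critical: "strongly_critical G \<Longrightarrow> critical G"
  by (auto simp: strongly_critical_def critical_def induced_subgraph_def)

section \<open>Special trees\<close>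

definition ends :: "'a pair_pre_digraph \<Rightarrow> 'a set" where
  "ends T = {v \<in> pverts T. \<forall>a b. (v, a) \<in> parcs T \<longrightarrow> (v, b) \<in> parcs T \<longrightarrow> a = b}"

abbreviation special_of :: "'a pair_pre_digraph \<Rightarrow> (('a + 'a set) + ('a + 'a set)) pair_pre_digraph" where
  "special_of T \<equiv> attach_pendants (subdivide_edges T)"

text \<open>Old vertices keep their degree, since the edges at \<open>v\<close> give different
  labels \<open>{v, a}\<close>, and subdividing vertices have degree 2. Hence pendant vertices are
  attached at old vertices only.\<close>

lemma leaves_subdivide_edges:
  assumes "pair_graph T"
  shows "leaves (subdivide_edges T) = Inl ` ends T"
proof -
  interpret T: pair_graph T by fact
  let ?S = "with_proj (subdivide_edges T)"
  have fin: "finite (parcs (subdivide_edges T))"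
    using T.pair_finite_arcs by (auto simp: subdivide_edges_def)
  have out: "out_arcs ?S v = {e \<in> parcs (subdivide_edges T). fst e = v}" for v
    by (auto simp: out_arcs_def)
  have deg: "out_degree ?S v \<le> 1 \<longleftrightarrow> (\<forall>a b. (v, a) \<in> parcs (subdivide_edges T) \<longrightarrow>
      (v, b) \<in> parcs (subdivide_edges T) \<longrightarrow> a = b)" for v
    unfolding out_degree_def out using fin by (simp add: card_le_Suc0_iff_eq)
  have arc: "(Inl v, z) \<in> parcs (subdivide_edges T) \<longleftrightarrow> (\<exists>a. (v, a) \<in> parcs T \<and> z = Inr {v, a})" for v z
    by (auto simp: subdivide_edges_def)
  have double: "{v, a} = {v, b} \<longleftrightarrow> a = b" for v a b :: 'a
    by (auto simp: doubleton_eq_iff)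
  have L: "out_degree ?S (Inl v) \<le> 1 \<longleftrightarrow> (\<forall>a b. (v, a) \<in> parcs T \<longrightarrow> (v, b) \<in> parcs T \<longrightarrow> a = b)" for v
  proof
    assume "out_degree ?S (Inl v) \<le> 1"
    then have "Inr {v, a} = (Inr {v, b} :: 'a + 'a set)" if "(v, a) \<in> parcs T" "(v, b) \<in> parcs T" for a b
      using that unfolding deg arc by blast
    then show "\<forall>a b. (v, a) \<in> parcs T \<longrightarrow> (v, b) \<in> parcs T \<longrightarrow> a = b" by (simp add: double)
  next
    assume "\<forall>a b. (v, a) \<in> parcs T \<longrightarrow> (v, b) \<in> parcs T \<longrightarrow> a = b"
    then show "out_degree ?S (Inl v) \<le> 1" unfolding deg arc by blast
  qed
  have "\<not> out_degree ?S (Inr {u, v}) \<le> 1" if uv: "(u, v) \<in> parcs T" for u v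
  proof -
    have "(v, u) \<in> parcs T" using uv T.arcs_symmetric by blast
    then have "(Inr {u, v}, Inl u) \<in> parcs (subdivide_edges T)" "(Inr {u, v}, Inl v) \<in> parcs (subdivide_edges T)"
      using uv by (force simp: subdivide_edges_def insert_commute)+
    moreover have "u \<noteq> v" using uv T.no_loops' by blast
    ultimately show ?thesis unfolding deg by blast
  qed
  then show ?thesis using L by (auto simp: leaves_def ends_def subdivide_edges_def)
qed

lemma special_of_eq:
  assumes "pair_graph T"
  shows "pverts (special_of T) = (\<lambda>v. Inl (Inl v)) ` pverts T
      \<union> (\<lambda>(u, v). Inl (Inr {u, v})) ` parcs T \<union> (\<lambda>v. Inr (Inl v)) ` ends T"
    and "parcs (special_of T) =
      (\<Union>(u, v)\<in>parcs T. {(Inl (Inl u), Inl (Inr {u, v})), (Inl (Inr {u, v}), Inl (Inl u))})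
      \<union> (\<Union>v\<in>ends T. {(Inl (Inl v), Inr (Inl v)), (Inr (Inl v), Inl (Inl v))})"
  using leaves_subdivide_edges[OF assms]
  by (auto simp: attach_pendants_def image_Un image_image) (auto simp: subdivide_edges_def image_iff split: prod.splits)

text \<open>A library isomorphism also carries a map on arcs; when tail and head are the
  projections, the vertex map determines it.\<close>

lemma digraph_iso_iff:
  assumes "pair_wf_digraph A"
  shows "digraph_iso (with_proj A) (with_proj B) \<longleftrightarrow>
    (\<exists>h. inj_on h (pverts A) \<and> pverts B = h ` pverts A \<and> parcs B = (\<lambda>(u, v). (h u, h v)) ` parcs A)"
proof
  assume "digraph_iso (with_proj A) (with_proj B)"
  then obtain f where f: "pre_digraph.digraph_isomorphism (with_proj A) f" "with_proj B = app_iso f (with_proj A)"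
    by (auto simp: digraph_iso_def)
  have t: "iso_tail f = fst" "iso_head f = snd"
    using arg_cong[OF f(2), of tail] arg_cong[OF f(2), of head] by simp_all
  have "iso_arcs f e = (\<lambda>(u, v). (iso_verts f u, iso_verts f v)) e" if "e \<in> parcs A" for e
    using f(1) that t unfolding pre_digraph.digraph_isomorphism_def by (auto simp: prod_eq_iff split: prod.splits)
  then have "parcs B = (\<lambda>(u, v). (iso_verts f u, iso_verts f v)) ` parcs A"
    using arg_cong[OF f(2), of arcs] by simp
  moreover have "pverts B = iso_verts f ` pverts A" using arg_cong[OF f(2), of verts] by simp
  moreover have "inj_on (iso_verts f) (pverts A)"
    using f(1) by (simp add: pre_digraph.digraph_isomorphism_def)
  ultimately show "\<exists>h. inj_on h (pverts A) \<and> pverts B = h ` pverts A \<and>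
    parcs B = (\<lambda>(u, v). (h u, h v)) ` parcs A" by blast
next
  interpret A: pair_wf_digraph A by fact
  assume "\<exists>h. inj_on h (pverts A) \<and> pverts B = h ` pverts A \<and> parcs B = (\<lambda>(u, v). (h u, h v)) ` parcs A"
  then obtain h where h: "inj_on h (pverts A)" "pverts B = h ` pverts A"
    "parcs B = (\<lambda>(u, v). (h u, h v)) ` parcs A" by blast
  define f where "f = \<lparr>iso_verts = h, iso_arcs = (\<lambda>(u, v). (h u, h v)), iso_head = snd, iso_tail = fst\<rparr>"
  have "inj_on (\<lambda>(u, v). (h u, h v)) (parcs A)"
    using h(1) by (auto simp: inj_on_def dest: A.in_arcsD1 A.in_arcsD2)
  then have "pre_digraph.digraph_isomorphism (with_proj A) f"
    using h(1) assms by (auto simp: pre_digraph.digraph_isomorphism_def f_def wf_digraph_wp_iff)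
  moreover have "with_proj B = app_iso f (with_proj A)"
    using h by (simp add: with_proj_def app_iso_def f_def)
  ultimately show "digraph_iso (with_proj A) (with_proj B)" unfolding digraph_iso_def by blast
qed

section \<open>Cycles and bridges\<close>

lemma pcas_rtrancl: "pcas u p v \<Longrightarrow> set p \<subseteq> R \<Longrightarrow> (u, v) \<in> R\<^sup>*"
  by (induct p arbitrary: u) (auto intro: converse_rtrancl_into_rtrancl)

lemma pawalk_verts_arcs: "pcas u p v \<Longrightarrow> (a, b) \<in> set p \<Longrightarrow> a \<in> set (pawalk_verts u p) \<and> b \<in> set (pawalk_verts u p)"
  by (induct p arbitrary: u) (auto, (metis list.set_intros(1) pawalk_verts.simps neq_Nil_conv pcas.simps(2))+)

lemma pawalk_verts_last: "pcas u p v \<Longrightarrow> v \<in> set (pawalk_verts u p)"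
  by (induct p arbitrary: u) auto

text \<open>The rest of the cycle after its first arc is a detour around that edge: the walk does
  not return to \<open>v\<close>, and the second arc is not the reverse of the first because
  \<open>w\<close> differs from \<open>u\<close>.\<close>

lemma long_cycle_bypass:
  assumes G: "pair_graph G" and p: "pre_digraph.cycle (with_proj G) p" "length p \<ge> 3"
  obtains u v where "(u, v) \<in> parcs G" "(v, u) \<in> (parcs G - {(u, v), (v, u)})\<^sup>*"
proof -
  interpret sgraph "parcs G" using pair_graph_sgraph[OF G] .
  obtain u where u: "pcas u p u" "set p \<subseteq> parcs G" "distinct (tl (pawalk_verts u p))"
    using p(1) by (auto simp: pre_digraph.cycle_def pre_digraph.awalk_def cas_with_proj_eq awalk_verts_with_proj_eq)
  obtain v w q where p_eq: "p = (u, v) # (v, w) # q" "q \<noteq> []"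
  proof -
    obtain e e' q where "p = e # e' # q" "q \<noteq> []" using p(2) by (cases p; cases "tl p"; cases "tl (tl p)") auto
    then show thesis using that[of "snd e" "snd e'" q] u(1) by (cases e; cases e') auto
  qed
  have q: "pcas w q u" and dist: "v \<notin> set (pawalk_verts w q)" "distinct (pawalk_verts w q)"
    using u p_eq by auto
  have "w \<noteq> u"
  proof
    assume "w = u"
    obtain e q' where e: "q = e # q'" using p_eq(2) by (cases q) auto
    then have "u \<in> set (pawalk_verts (snd e) q')" using q pawalk_verts_last by auto
    then show False using dist(2) e q \<open>w = u\<close> by auto
  qed
  have "(v, w) \<in> parcs G - {(u, v), (v, u)}"
    using u(2) p_eq \<open>w \<noteq> u\<close> irr by auto
  moreover have "set q \<subseteq> parcs G - {(u, v), (v, u)}"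
    using u(2) p_eq pawalk_verts_arcs[OF q] dist(1) by auto
  then have "(w, u) \<in> (parcs G - {(u, v), (v, u)})\<^sup>*" using pcas_rtrancl[OF q] by blast
  ultimately have "(v, u) \<in> (parcs G - {(u, v), (v, u)})\<^sup>*" by (rule converse_rtrancl_into_rtrancl)
  then show thesis using that u(2) p_eq by auto
qed

text \<open>A shortest detour around the edge would close up with it to a cycle that a tree does not
  have.\<close>

lemma undirected_tree_bridge:
  assumes T: "undirected_tree T" and ab: "(a, b) \<in> parcs T"
  shows "(a, b) \<notin> (parcs T - {(a, b), (b, a)})\<^sup>*"
proof
  let ?R = "parcs T - {(a, b), (b, a)}"
  have G: "pair_graph T" using T by (simp add: undirected_tree_def)
  interpret sgraph "parcs T" using pair_graph_sgraph[OF G] .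
  assume "(a, b) \<in> ?R\<^sup>*"
  then obtain n0 where n0: "(a, b) \<in> ?R ^^ n0" by (auto dest: rtrancl_imp_relpow)
  define n where "n = (LEAST n. (a, b) \<in> ?R ^^ n)"
  have n: "(a, b) \<in> ?R ^^ n" unfolding n_def by (rule LeastI[of _ n0]) (rule n0)
  have least: "(a, b) \<notin> ?R ^^ m" if "m < n" for m using not_less_Least that unfolding n_def by blast
  obtain f where f: "f 0 = a" "f n = b" "\<And>i. i < n \<Longrightarrow> (f i, f (Suc i)) \<in> ?R" "inj_on f {..n}"
    using shortest_path[OF n least] by metis
  have "a \<noteq> b" using ab irr by auto
  then obtain k where k: "n = Suc k" using f(1,2) by (cases n) auto
  \<comment> \<open>A detour of one arc would be the deleted edge itself, so the cycle of
    \<open>k + 2\<close> arcs has length at least 3.\<close>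
  have "k \<noteq> 0" using f(1,2) f(3)[of 0] k by (cases k) auto
  have "pre_digraph.cycle (with_proj T) ((b, f 0) # map (\<lambda>i. (f i, f (Suc i))) [0..<k] @ [(f k, b)])"
  proof (rule closed_path_cycle)
    show "inj_on f {..k}" by (rule inj_on_subset[OF f(4)]) (simp add: k)
    show "b \<notin> f ` {..k}"
    proof
      assume "b \<in> f ` {..k}"
      then obtain i where "i \<le> k" "f i = f n" using f(2) by auto
      then show False using inj_onD[OF f(4), of i n] k by auto
    qed
    show "b \<in> pverts T" using ab pair_graph_parcs[OF G] by auto
    show "(b, f 0) \<in> parcs T" using ab sym f(1) by blast
    show "(f i, f (Suc i)) \<in> parcs T" if "i < k" for i using f(3)[of i] that k by auto
    show "(f k, b) \<in> parcs T" using f(3)[of k] f(2) k by auto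
  qed
  then have "length ((b, f 0) # map (\<lambda>i. (f i, f (Suc i))) [0..<k] @ [(f k, b)]) < 3"
    using T unfolding undirected_tree_def by blast
  then show False using \<open>k \<noteq> 0\<close> by simp
qed

text \<open>The only condition that is not local is the separation at a subdividing vertex; it
  expresses that the subdivided edge is a bridge of \<open>T\<close>.\<close>

lemma special_of_structure:
  assumes T: "undirected_tree T"
  shows "special_structure (parcs (special_of T)) (pverts (special_of T))
    ((\<lambda>v. Inl (Inl v)) ` pverts T) ((\<lambda>(u, v). Inl (Inr {u, v})) ` parcs T) ((\<lambda>v. Inr (Inl v)) ` ends T)"
proof -
  let ?E = "parcs (special_of T)" and ?V = "pverts (special_of T)"
  let ?Y = "(\<lambda>(u, v). Inl (Inr {u, v})) ` parcs T :: (('a + 'a set) + ('a + 'a set)) set"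
  have G: "pair_graph T" using T by (simp add: undirected_tree_def)
  interpret T: sgraph "parcs T" using pair_graph_sgraph[OF G] .
  note V = special_of_eq(1)[OF G] and E = special_of_eq(2)[OF G]
  have TV: "u \<in> pverts T" "v \<in> pverts T" if "(u, v) \<in> parcs T" for u v
    using that pair_graph_parcs[OF G] by auto
  have e1: "(Inl (Inl u), z) \<in> ?E \<longleftrightarrow> (\<exists>v. (u, v) \<in> parcs T \<and> z = Inl (Inr {u, v})) \<or> (u \<in> ends T \<and> z = Inr (Inl u))" for u z
    unfolding E by auto
  have e2: "(Inl (Inr e), z) \<in> ?E \<longleftrightarrow> (\<exists>u v. (u, v) \<in> parcs T \<and> e = {u, v} \<and> z = Inl (Inl u))" for e z
    unfolding E by auto
  have e3: "(Inr (Inl u), z) \<in> ?E \<longleftrightarrow> u \<in> ends T \<and> z = Inl (Inl u)" for u z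
    unfolding E by auto
  have e4: "(Inr (Inr u), z) \<notin> ?E" for u z
    unfolding E by auto
  have e2': "(Inl (Inr {a, b}), z) \<in> ?E \<longleftrightarrow> z = Inl (Inl a) \<or> z = Inl (Inl b)" if "(a, b) \<in> parcs T" for a b z
    using that T.sym[OF that] unfolding e2 by (auto simp: doubleton_eq_iff)
  have fin: "finite (pverts T)" "finite (parcs T)" "finite (ends T)"
    using pair_graph_finite[OF G] pair_graph_parcs[OF G] by (auto simp: ends_def intro: finite_subset)
  interpret M: sgraph ?E
    by unfold_locales (auto simp: E)
  show ?thesis
  proof (unfold_locales; (rule V)?)
    show "finite ?V" unfolding V using fin by simp
    show "conn ?E ?V"
    proof -
      have c: "conn (parcs T) (pverts T)" using T connected_iff[OF G] by (simp add: undirected_tree_def)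
      then obtain r where r: "r \<in> pverts T" by (auto simp: conn_def)
      have tree: "(Inl (Inl r), Inl (Inl v)) \<in> M.rch ?V" if "v \<in> pverts T" for v
      proof -
        have "(r, v) \<in> T.rch (pverts T)" using c r that by (auto simp: conn_def)
        then show ?thesis
        proof (induct rule: rtrancl_on_induct)
          case base
          then show ?case using V by auto
        next
          case (step y z)
          have "(Inl (Inl y), Inl (Inr {y, z})) \<in> ?E" "(Inl (Inr {y, z}), Inl (Inl z)) \<in> ?E"
            using step(2) by (auto simp: e1 e2')
          moreover have "Inl (Inr {y, z}) \<in> ?V" "Inl (Inl z) \<in> ?V" using step(2,4) unfolding V by auto
          ultimately show ?case using step(5) by (blast intro: rtrancl_on_into_rtrancl_on)
        qed
      qed
      show ?thesis
      proof (rule M.conn_rchI[of "Inl (Inl r)"])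
        show "Inl (Inl r) \<in> ?V" using r V by auto
        fix z assume z: "z \<in> ?V"
        have "\<exists>v\<in>pverts T. z = Inl (Inl v) \<or> (Inl (Inl v), z) \<in> ?E"
          using z TV by (auto simp: V e1 ends_def)
        then obtain v where "v \<in> pverts T" "z = Inl (Inl v) \<or> (Inl (Inl v), z) \<in> ?E" by blast
        then show "(Inl (Inl r), z) \<in> M.rch ?V"
          using tree[of v] z by (auto intro: rtrancl_on_into_rtrancl_on)
      qed
    qed
    show "?E \<subseteq> (\<lambda>v. Inl (Inl v)) ` pverts T \<times> (?Y \<union> (\<lambda>v. Inr (Inl v)) ` ends T) \<union>
      (?Y \<union> (\<lambda>v. Inr (Inl v)) ` ends T) \<times> (\<lambda>v. Inl (Inl v)) ` pverts T"
      unfolding E using TV by (auto simp: ends_def)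
    show "\<exists>x. ?E `` {l} = {x}" if "l \<in> (\<lambda>v. Inr (Inl v)) ` ends T" for l
      using that by (auto simp: set_eq_iff e3)
    show "\<exists>c d. c \<noteq> d \<and> ?E `` {y} = {c, d} \<and> (c, d) \<notin> M.rch (?V - {y})" if y: "y \<in> ?Y" for y
    proof -
      obtain a b where ab: "(a, b) \<in> parcs T" "y = Inl (Inr {a, b})" using y by auto
      let ?R = "parcs T - {(a, b), (b, a)}"
      have "?E `` {y} = {Inl (Inl a), Inl (Inl b)}" using e2'[OF ab(1)] ab(2) by auto
      moreover have "a \<noteq> b" using ab T.irr by auto
      moreover have "(Inl (Inl a), Inl (Inl b)) \<notin> M.rch (?V - {y})"
      proof
        \<comment> \<open>Walks avoiding \<open>y\<close> are projected to walks in \<open>T\<close>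
          without the edge ab. On reaching a subdividing vertex, both ends of its edge must count as
          reached, since the walk may continue to either.\<close>
        have "case z of Inl (Inl v) \<Rightarrow> (a, v) \<in> ?R\<^sup>* | Inl (Inr e) \<Rightarrow> \<forall>v\<in>e. (a, v) \<in> ?R\<^sup>*
           | Inr (Inl v) \<Rightarrow> (a, v) \<in> ?R\<^sup>* | Inr (Inr _) \<Rightarrow> True"
          if "(Inl (Inl a), z) \<in> M.rch (?V - {y})" for z
          using that
        proof (induct rule: rtrancl_on_induct)
          case base
          then show ?case by simp
        next
          case (step w z)
          show ?case
          proof (cases w)
            case (Inl w')
            show ?thesis
            proof (cases w')
              case (Inl u)
              then have u: "(a, u) \<in> ?R\<^sup>*" "(Inl (Inl u), z) \<in> ?E" using step \<open>w = Inl w'\<close> by auto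
              from u(2) show ?thesis unfolding e1
              proof (elim disjE exE conjE)
                fix v assume v: "(u, v) \<in> parcs T" "z = Inl (Inr {u, v})"
                then have "(u, v) \<in> ?R" using step(4) ab by (auto simp: doubleton_eq_iff)
                then show ?thesis using u(1) v(2) by (auto intro: rtrancl_into_rtrancl)
              qed (use u in auto)
            next
              case (Inr e)
              then have "\<forall>v\<in>e. (a, v) \<in> ?R\<^sup>*" "(Inl (Inr e), z) \<in> ?E" using step \<open>w = Inl w'\<close> by auto
              then show ?thesis by (auto simp: e2)
            qed
          next
            case (Inr w')
            show ?thesis
            proof (cases w')
              case (Inl u)
              then have "(a, u) \<in> ?R\<^sup>*" "(Inr (Inl u), z) \<in> ?E" using step \<open>w = Inr w'\<close> by auto
              then show ?thesis by (auto simp: e3)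
            next
              case (Inr u)
              then show ?thesis using step e4 \<open>w = Inr w'\<close> by auto
            qed
          qed
        qed
        moreover assume "(Inl (Inl a), Inl (Inl b)) \<in> M.rch (?V - {y})"
        ultimately have "(a, b) \<in> ?R\<^sup>*" by fastforce
        then show False using undirected_tree_bridge[OF T ab(1)] by simp
      qed
      ultimately show ?thesis by (intro exI[of _ "Inl (Inl a)"] exI[of _ "Inl (Inl b)"]) simp
    qed
    show "if \<exists>y\<in>?Y. \<exists>y'\<in>?Y. y \<noteq> y' \<and> (x, y) \<in> ?E \<and> (x, y') \<in> ?E
        then ?E `` {x} \<inter> (\<lambda>v. Inr (Inl v)) ` ends T = {}
        else \<exists>l. ?E `` {x} \<inter> (\<lambda>v. Inr (Inl v)) ` ends T = {l}"
      if x: "x \<in> (\<lambda>v. Inl (Inl v)) ` pverts T" for x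
    proof -
      obtain v where v: "v \<in> pverts T" "x = Inl (Inl v)" using x by auto
      show ?thesis
      proof (cases "v \<in> ends T")
        case True
        then have "?E `` {x} \<inter> (\<lambda>v. Inr (Inl v)) ` ends T = {Inr (Inl v)}" using v by (auto simp: e1)
        moreover have "\<not> (\<exists>y\<in>?Y. \<exists>y'\<in>?Y. y \<noteq> y' \<and> (x, y) \<in> ?E \<and> (x, y') \<in> ?E)"
        proof
          assume "\<exists>y\<in>?Y. \<exists>y'\<in>?Y. y \<noteq> y' \<and> (x, y) \<in> ?E \<and> (x, y') \<in> ?E"
          then obtain y y' where y: "y \<in> ?Y" "y' \<in> ?Y" "y \<noteq> y'" "(x, y) \<in> ?E" "(x, y') \<in> ?E" by blast
          obtain e e' where e: "y = Inl (Inr e)" "y' = Inl (Inr e')" using y(1,2) by auto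
          then obtain a a' where "(v, a) \<in> parcs T" "e = {v, a}" "(v, a') \<in> parcs T" "e' = {v, a'}"
            using y(4,5) unfolding v(2) e e1 by auto
          then show False using True y(3) e by (auto simp: ends_def)
        qed
        ultimately show ?thesis by auto
      next
        case False
        then obtain a b where ab: "(v, a) \<in> parcs T" "(v, b) \<in> parcs T" "a \<noteq> b" using v by (auto simp: ends_def)
        have vab: "(x, Inl (Inr {v, a})) \<in> ?E" "(x, Inl (Inr {v, b})) \<in> ?E"
          unfolding v(2) e1 using ab by blast+
        have "{v, a} \<noteq> {v, b}" using ab(3) by (simp add: doubleton_eq_iff)
        moreover have "Inl (Inr {v, a}) \<in> ?Y" by (rule image_eqI[OF _ ab(1)]) simp
        moreover have "Inl (Inr {v, b}) \<in> ?Y" by (rule image_eqI[OF _ ab(2)]) simp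
        ultimately have "\<exists>y\<in>?Y. \<exists>y'\<in>?Y. y \<noteq> y' \<and> (x, y) \<in> ?E \<and> (x, y') \<in> ?E"
          using vab by (intro bexI[of _ "Inl (Inr {v, a})"] bexI[of _ "Inl (Inr {v, b})"]) auto
        moreover have "?E `` {x} \<inter> (\<lambda>v. Inr (Inl v)) ` ends T = {}" using v False by (auto simp: e1)
        ultimately show ?thesis by simp
      qed
    qed
  qed auto
qed

text \<open>Carries the structure from the nested sum type of the construction to the vertex type of
  \<open>G\<close>.\<close>

lemma (in special_structure) image_structure:
  assumes h: "inj_on h V"
  shows "special_structure ((\<lambda>(u, v). (h u, h v)) ` E) (h ` V) (h ` X) (h ` Y) (h ` L)"
proof -
  let ?F = "(\<lambda>(u, v). (h u, h v)) ` E"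
  have sub: "X \<subseteq> V" "Y \<subseteq> V" "L \<subseteq> V" using V_eq by auto
  have EV': "u \<in> V" "v \<in> V" if "(u, v) \<in> E" for u v using that EV by auto
  have F: "(h u, h v) \<in> ?F \<longleftrightarrow> (u, v) \<in> E" if "u \<in> V" "v \<in> V" for u v
  proof
    assume "(h u, h v) \<in> ?F"
    then obtain a b where ab: "(a, b) \<in> E" "h a = h u" "h b = h v" by auto
    then have "a = u" "b = v" using inj_onD[OF h] EV' that by blast+
    then show "(u, v) \<in> E" using ab by simp
  qed (auto intro: rev_image_eqI)
  have nb: "?F `` {h u} = h ` (E `` {u})" if u: "u \<in> V" for u
  proof
    show "?F `` {h u} \<subseteq> h ` (E `` {u})"
    proof
      fix z assume "z \<in> ?F `` {h u}"
      then obtain a b where ab: "(a, b) \<in> E" "h a = h u" "z = h b" by auto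
      then have "a = u" using inj_onD[OF h] EV'(1) u by blast
      then show "z \<in> h ` (E `` {u})" using ab by auto
    qed
  qed (auto intro: rev_image_eqI)
  have inter: "h ` (E `` {u}) \<inter> h ` L = h ` (E `` {u} \<inter> L)" if "u \<in> V" for u
    by (rule inj_on_image_Int[OF h, symmetric]) (use EV' sub in auto)
  \<comment> \<open>Separation is a negative statement, so walks in the image must be lifted back;
    injectivity makes this possible.\<close>
  have pull: "\<exists>b. v = h b \<and> (a, b) \<in> rch W" if W: "W \<subseteq> V" and a: "a \<in> W" and v: "(h a, v) \<in> rtrancl_on (h ` W) ?F" for W a v
    using v
  proof (induct rule: rtrancl_on_induct)
    case base
    then show ?case using a by auto
  next
    case (step y z)
    then obtain b c where b: "y = h b" "(a, b) \<in> rch W" "z = h c" "c \<in> W" by auto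
    have "b \<in> W" using b(2) by (auto dest: in_rtrancl_on_in_F)
    then have "b \<in> V" "c \<in> V" using b W by auto
    then have "(b, c) \<in> E" using step(2) F unfolding b by blast
    then show ?case using b by (auto intro: rtrancl_on_into_rtrancl_on)
  qed
  have forth: "(h a, h b) \<in> rtrancl_on (h ` V) ?F" if "(a, b) \<in> rch V" for a b
    using that
  proof (induct rule: rtrancl_on_induct)
    case (step y z)
    then have "(h y, h z) \<in> ?F" by (auto intro: rev_image_eqI)
    then show ?case using step by (auto intro: rtrancl_on_into_rtrancl_on)
  qed auto
  show ?thesis
  proof unfold_locales
    show "(v, u) \<in> ?F" if "(u, v) \<in> ?F" for u v using that sym by (force simp: image_iff)
    show "(u, u) \<notin> ?F" for u
    proof
      assume "(u, u) \<in> ?F"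
      then obtain a b where ab: "(a, b) \<in> E" "h a = h b" by auto
      then have "a = b" using inj_onD[OF h] EV' by blast
      then show False using ab irr by simp
    qed
    show "finite (h ` V)" using fin by simp
    show "conn ?F (h ` V)" using conn forth unfolding conn_def by blast
    show "h ` V = h ` X \<union> h ` Y \<union> h ` L" using V_eq by auto
    show "h ` X \<inter> h ` Y = {}" "h ` X \<inter> h ` L = {}" "h ` Y \<inter> h ` L = {}"
      using inj_on_image_Int[OF h sub(1,2)] inj_on_image_Int[OF h sub(1,3)]
        inj_on_image_Int[OF h sub(2,3)] disj by simp_all
    show "?F \<subseteq> h ` X \<times> (h ` Y \<union> h ` L) \<union> (h ` Y \<union> h ` L) \<times> h ` X"
      using edges by auto
    show "\<exists>a b. a \<noteq> b \<and> ?F `` {y} = {a, b} \<and> (a, b) \<notin> rtrancl_on (h ` V - {y}) ?F"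
      if y: "y \<in> h ` Y" for y
    proof -
      obtain y' where y': "y' \<in> Y" "y = h y'" using y by auto
      obtain a b where ab: "a \<noteq> b" "E `` {y'} = {a, b}" "(a, b) \<notin> rch (V - {y'})"
        using Y_nb[OF y'(1)] by blast
      have y'V: "y' \<in> V" using y' sub by auto
      have "(y', a) \<in> E" "(y', b) \<in> E" using ab(2) by auto
      then have V: "a \<in> V - {y'}" "b \<in> V - {y'}" using EV' irr by auto
      have "h ` V - {y} = h ` (V - {y'})" using inj_on_image_set_diff[OF h, of V "{y'}"] y'V y' by auto
      moreover have "(h a, h b) \<notin> rtrancl_on (h ` (V - {y'})) ?F"
      proof
        assume "(h a, h b) \<in> rtrancl_on (h ` (V - {y'})) ?F"
        then obtain b' where b': "h b = h b'" "(a, b') \<in> rch (V - {y'})"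
          using pull[OF _ V(1)] by blast
        have "b' \<in> V" using b'(2) by (auto dest: in_rtrancl_on_in_F)
        then have "b = b'" using inj_onD[OF h b'(1)] V by auto
        then show False using ab(3) b'(2) by simp
      qed
      moreover have "?F `` {y} = {h a, h b}" using nb[OF y'V] ab(2) y' by simp
      moreover have "h a \<noteq> h b" using inj_onD[OF h, of a b] V ab(1) by auto
      ultimately show ?thesis by (intro exI[of _ "h a"] exI[of _ "h b"]) simp
    qed
    show "\<exists>x. ?F `` {l} = {x}" if l: "l \<in> h ` L" for l
    proof -
      obtain l' where l': "l' \<in> L" "l = h l'" using l by auto
      then obtain x where "E `` {l'} = {x}" using L_nb by blast
      moreover have "l' \<in> V" using l' sub by auto
      ultimately have "?F `` {l} = {h x}" using nb[of l'] l'(2) by simp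
      then show ?thesis by blast
    qed
    show "if \<exists>y\<in>h ` Y. \<exists>y'\<in>h ` Y. y \<noteq> y' \<and> (x, y) \<in> ?F \<and> (x, y') \<in> ?F
        then ?F `` {x} \<inter> h ` L = {} else \<exists>l. ?F `` {x} \<inter> h ` L = {l}"
      if x: "x \<in> h ` X" for x
    proof -
      obtain x' where x': "x' \<in> X" "x = h x'" using x by auto
      have x'V: "x' \<in> V" using x' sub by auto
      have eq: "?F `` {x} \<inter> h ` L = h ` (E `` {x'} \<inter> L)"
        using nb[OF x'V] inter[OF x'V] x' by simp
      have "(\<exists>y\<in>h ` Y. \<exists>y'\<in>h ` Y. y \<noteq> y' \<and> (x, y) \<in> ?F \<and> (x, y') \<in> ?F)
        \<longleftrightarrow> (\<exists>y\<in>Y. \<exists>y'\<in>Y. h y \<noteq> h y' \<and> (h x', h y) \<in> ?F \<and> (h x', h y') \<in> ?F)"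
        using x' by auto
      also have "\<dots> \<longleftrightarrow> (\<exists>y\<in>Y. \<exists>y'\<in>Y. y \<noteq> y' \<and> (x', y) \<in> E \<and> (x', y') \<in> E)"
        by (simp add: F[OF x'V] subsetD[OF sub(2)] inj_on_eq_iff[OF h] cong: bex_cong)
      finally show ?thesis using X_nb[OF x'(1)] unfolding eq by (auto split: if_splits)
    qed
  qed
qed

lemma special_tree_structure:
  assumes "special_tree G"
  obtains X Y L where "special_structure (parcs G) (pverts G) X Y L" "parcs G \<noteq> {}"
proof -
  obtain T :: "'a pair_pre_digraph" where T: "undirected_tree T"
    "digraph_iso (with_proj (special_of T)) (with_proj G)"
    using assms by (auto simp: special_tree_def)
  interpret S: special_structure "parcs (special_of T)" "pverts (special_of T)"
    "(\<lambda>v. Inl (Inl v)) ` pverts T" "(\<lambda>(u, v). Inl (Inr {u, v})) ` parcs T" "(\<lambda>v. Inr (Inl v)) ` ends T"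
    by (rule special_of_structure[OF T(1)])
  have wf: "pair_wf_digraph (special_of T)"
    using S.EV by unfold_locales auto
  obtain h where h: "inj_on h (pverts (special_of T))" "pverts G = h ` pverts (special_of T)"
    "parcs G = (\<lambda>(u, v). (h u, h v)) ` parcs (special_of T)"
    using T(2) unfolding digraph_iso_iff[OF wf] by blast
  have G: "pair_graph T" using T(1) by (simp add: undirected_tree_def)
  obtain r where r: "r \<in> pverts T" using T(1) connected_iff[OF G] by (auto simp: undirected_tree_def conn_def)
  \<comment> \<open>An end carries a pendant edge, which also settles the one-vertex tree; any other
    vertex has an edge that gets subdivided.\<close>
  have "parcs (special_of T) \<noteq> {}"
  proof (cases "r \<in> ends T")
    case False
    then obtain a where "(r, a) \<in> parcs T" using r by (auto simp: ends_def)
    then have "(Inl (Inl r), Inl (Inr {r, a})) \<in> parcs (special_of T)"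
      unfolding special_of_eq(2)[OF G] by blast
    then show ?thesis by blast
  qed (auto simp: special_of_eq(2)[OF G])
  then have "parcs G \<noteq> {}" using h(3) by simp
  then show thesis using that S.image_structure[OF h(1)] h by simp
qed

section \<open>Recovering the tree and the isomorphism\<close>

context special_structure
begin

text \<open>The edge replacing \<open>y\<close> is its neighbourhood, which is exactly the label
  that \<open>subdivide_edges\<close> gives to the subdividing vertex.\<close>

definition base_tree :: "'a pair_pre_digraph" where
  "base_tree = \<lparr>pverts = X, parcs = {(a, b). a \<noteq> b \<and> (\<exists>y\<in>Y. E `` {y} = {a, b})}\<rparr>"

text \<open>Another vertex with the same two neighbours would join them around \<open>y\<close>. So
  distinct vertices of \<open>Y\<close> never yield parallel edges.\<close>

lemma Y_inj: "inj_on (\<lambda>y. E `` {y}) Y"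
proof (rule inj_onI, rule ccontr)
  fix y y' assume y: "y \<in> Y" "y' \<in> Y" "E `` {y} = E `` {y'}" "y \<noteq> y'"
  obtain a b where ab: "E `` {y} = {a, b}" "(a, b) \<notin> rch (V - {y})" using Y_nb[OF y(1)] by blast
  have "(y, a) \<in> E" "(y', a) \<in> E" "(y', b) \<in> E" "(y, b) \<in> E" using ab(1) y(3) by auto
  moreover from this have "a \<in> V - {y}" "b \<in> V - {y}" "y' \<in> V - {y}" using EV irr y(4) by auto
  ultimately have "(a, b) \<in> rch (V - {y})"
    using sym by (meson rtrancl_on_edge rtrancl_on_into_rtrancl_on)
  then show False using ab(2) by simp
qed

text \<open>\<open>X_nb\<close> allows at most one pendant neighbour at each vertex of
  \<open>X\<close>.\<close>

lemma L_inj: "inj_on (\<lambda>l. E `` {l}) L"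
proof (rule inj_onI)
  fix l l' assume l: "l \<in> L" "l' \<in> L" "E `` {l} = E `` {l'}"
  obtain x where x: "E `` {l} = {x}" using L_nb[OF l(1)] by blast
  then have "(l, x) \<in> E" "(l', x) \<in> E" using l(3) by auto
  then have mem: "l \<in> E `` {x} \<inter> L" "l' \<in> E `` {x} \<inter> L" and xX: "x \<in> X"
    using l(1,2) sym nonX_adj[of l x] by auto
  then have "E `` {x} \<inter> L \<noteq> {}" by blast
  then obtain m where "E `` {x} \<inter> L = {m}" using X_nb[OF xX] by (auto split: if_splits)
  then show "l = l'" using mem by auto
qed

lemma base_arcE:
  assumes "(a, b) \<in> parcs base_tree"
  obtains y where "y \<in> Y" "E `` {y} = {a, b}" "(a, y) \<in> E" "(y, b) \<in> E" "a \<in> X" "b \<in> X" "a \<noteq> b"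
proof -
  obtain y where y: "y \<in> Y" "E `` {y} = {a, b}" "a \<noteq> b" using assms by (auto simp: base_tree_def)
  then have "(y, a) \<in> E" "(y, b) \<in> E" by auto
  then show thesis using that y sym nonX_adj by blast
qed

lemma base_arcI: "y \<in> Y \<Longrightarrow> (a, y) \<in> E \<Longrightarrow> (y, b) \<in> E \<Longrightarrow> a \<noteq> b \<Longrightarrow> (a, b) \<in> parcs base_tree \<and> E `` {y} = {a, b}"
proof -
  assume y: "y \<in> Y" "(a, y) \<in> E" "(y, b) \<in> E" "a \<noteq> b"
  have "a \<in> E `` {y}" "b \<in> E `` {y}" using y sym by auto
  then have "E `` {y} = {a, b}" using Y_nb[OF y(1)] y(4) by (elim exE conjE) auto
  then show ?thesis using y by (auto simp: base_tree_def)
qed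

lemma base_tree_graph: "pair_graph base_tree"
proof (rule pair_graphI)
  show "sgraph (parcs base_tree)"
    by unfold_locales (auto simp: base_tree_def insert_commute)
  show "parcs base_tree \<subseteq> pverts base_tree \<times> pverts base_tree"
  proof
    fix e assume "e \<in> parcs base_tree"
    then show "e \<in> pverts base_tree \<times> pverts base_tree"
      using base_arcE[of "fst e" "snd e"] by (cases e) (auto simp: base_tree_def)
  qed
qed (use fin_XY in \<open>auto simp: base_tree_def\<close>)

text \<open>Walks in \<open>V\<close> contract to walks in the base tree, which gives connectivity.
  Conversely, a detour around an edge of the base tree expands to a walk avoiding the corresponding
  \<open>y\<close>, against \<open>Y_nb\<close>.\<close>

lemma base_tree_tree:
  assumes "E \<noteq> {}"
  shows "undirected_tree base_tree"
proof -
  let ?T = "parcs base_tree"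
  interpret T: sgraph ?T using pair_graph_sgraph[OF base_tree_graph] .
  have verts: "pverts base_tree = X" by (simp add: base_tree_def)
  obtain x0 where x0: "x0 \<in> X" using X_nonempty[OF assms] by auto
  have x0V: "x0 \<in> V" using x0 V_eq by auto
  have reach: "if v \<in> X then (x0, v) \<in> T.rch X else \<forall>x\<in>E `` {v}. (x0, x) \<in> T.rch X"
    if "(x0, v) \<in> rch V" for v
    using that
  proof (induct rule: rtrancl_on_induct)
    case base
    then show ?case using x0 by auto
  next
    case (step y z)
    show ?case
    proof (cases "y \<in> X")
      case True
      then have z: "z \<in> Y \<union> L" "z \<notin> X" using X_adj step disj by auto
      have "(x0, x) \<in> T.rch X" if x: "(z, x) \<in> E" for x
      proof (cases "x = y")
        case False
        have "z \<notin> L"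
        proof
          assume "z \<in> L"
          then obtain u where u: "E `` {z} = {u}" using L_nb by blast
          have "x \<in> E `` {z}" "y \<in> E `` {z}" using x step sym by auto
          then show False using False u by simp
        qed
        then have "(y, x) \<in> ?T" using base_arcI[of z y x] z x step False by auto
        moreover have "x \<in> X" using nonX_adj[OF z(1) x] .
        ultimately show ?thesis using step(5) True by (auto intro: rtrancl_on_into_rtrancl_on)
      qed (use step(5) True in simp)
      then show ?thesis using z by auto
    next
      case False
      then have "z \<in> X" using nonX_adj[of y z] step V_eq by auto
      then show ?thesis using step(2,5) False by auto
    qed
  qed
  have "conn ?T X"
  proof (rule T.conn_rchI[OF x0])
    fix v assume v: "v \<in> X"
    then have "(x0, v) \<in> rch V" using conn x0V V_eq by (auto simp: conn_def)
    then show "(x0, v) \<in> T.rch X" using reach[of v] v by simp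
  qed
  moreover have "length p < 3" if p: "pre_digraph.cycle (with_proj base_tree) p" for p
  proof (rule ccontr)
    assume "\<not> length p < 3"
    then obtain u v where uv: "(u, v) \<in> ?T" "(v, u) \<in> (?T - {(u, v), (v, u)})\<^sup>*"
      using long_cycle_bypass[OF base_tree_graph p] by (metis not_le)
    obtain y where y: "y \<in> Y" "E `` {y} = {u, v}" "u \<in> X" "v \<in> X" "u \<noteq> v"
      using base_arcE[OF uv(1)] .
    have XV: "x \<in> V - {y}" if "x \<in> X" for x using that y(1) disj V_eq by auto
    from uv(2) have "(v, u) \<in> rch (V - {y})"
    proof (induct rule: rtrancl_induct)
      case base
      then show ?case using XV y by auto
    next
      case (step a b)
      obtain z where z: "z \<in> Y" "E `` {z} = {a, b}" "(a, z) \<in> E" "(z, b) \<in> E" "a \<in> X" "b \<in> X" "a \<noteq> b"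
        using base_arcE[OF DiffD1[OF step(2)]] .
      have "z \<noteq> y" using z(2) y(2) step(2) by (auto simp: doubleton_eq_iff)
      then have "z \<in> V - {y}" using z(1) V_eq by auto
      then show ?case using step(3) z XV by (meson rtrancl_on_into_rtrancl_on)
    qed
    moreover have "(v, u) \<notin> rch (V - {y})"
      using Y_nb[OF y(1)] y(2) rch_sym[of v u] by (auto simp: doubleton_eq_iff)
    ultimately show False by simp
  qed
  ultimately show ?thesis
    using base_tree_graph connected_iff[OF base_tree_graph] verts by (simp add: undirected_tree_def)
qed

text \<open>By \<open>Y_inj\<close>, edges of the base tree at \<open>x\<close> correspond to
  neighbours of \<open>x\<close> in \<open>Y\<close>, so \<open>X_nb\<close> decides between an end
  and an inner vertex.\<close>

lemma ends_base_tree: "ends base_tree = {x \<in> X. E `` {x} \<inter> L \<noteq> {}}"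
proof -
  have "(\<forall>a b. (x, a) \<in> parcs base_tree \<longrightarrow> (x, b) \<in> parcs base_tree \<longrightarrow> a = b) \<longleftrightarrow> E `` {x} \<inter> L \<noteq> {}"
    if x: "x \<in> X" for x
  proof -
    have "(\<exists>y\<in>Y. \<exists>y'\<in>Y. y \<noteq> y' \<and> (x, y) \<in> E \<and> (x, y') \<in> E) \<longleftrightarrow>
      (\<exists>a b. (x, a) \<in> parcs base_tree \<and> (x, b) \<in> parcs base_tree \<and> a \<noteq> b)" (is "?l \<longleftrightarrow> ?r")
    proof
      assume ?l
      then obtain y y' where y: "y \<in> Y" "y' \<in> Y" "y \<noteq> y'" "(x, y) \<in> E" "(x, y') \<in> E" by blast
      have other: "\<exists>a. (y, a) \<in> E \<and> a \<noteq> x" if y: "y \<in> Y" for y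
      proof -
        obtain a b where ab: "a \<noteq> b" "E `` {y} = {a, b}" using Y_nb[OF y] by blast
        then have "(y, a) \<in> E" "(y, b) \<in> E" by auto
        then show ?thesis using ab(1) by metis
      qed
      obtain a where a: "(y, a) \<in> E" "a \<noteq> x" using other y(1) by blast
      obtain b where b: "(y', b) \<in> E" "b \<noteq> x" using other y(2) by blast
      have ya: "(x, a) \<in> parcs base_tree" "E `` {y} = {x, a}" using base_arcI[OF y(1,4) a(1)] a(2) by auto
      have yb: "(x, b) \<in> parcs base_tree" "E `` {y'} = {x, b}" using base_arcI[OF y(2,5) b(1)] b(2) by auto
      have "a \<noteq> b" using inj_onD[OF Y_inj, of y y'] ya(2) yb(2) y by auto
      then show ?r using ya yb by blast
    next
      assume ?r
      then obtain a b where ab: "(x, a) \<in> parcs base_tree" "(x, b) \<in> parcs base_tree" "a \<noteq> b" by blast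
      obtain y where y: "y \<in> Y" "E `` {y} = {x, a}" "(x, y) \<in> E" using base_arcE[OF ab(1)] .
      obtain y' where y': "y' \<in> Y" "E `` {y'} = {x, b}" "(x, y') \<in> E" using base_arcE[OF ab(2)] .
      have "y \<noteq> y'" using y(2) y'(2) ab(3) by (auto simp: doubleton_eq_iff)
      then show ?l using y y' by blast
    qed
    moreover have "(\<exists>y\<in>Y. \<exists>y'\<in>Y. y \<noteq> y' \<and> (x, y) \<in> E \<and> (x, y') \<in> E) \<longleftrightarrow> E `` {x} \<inter> L = {}"
      using X_nb[OF x] by (auto split: if_splits)
    ultimately show ?thesis by blast
  qed
  then show ?thesis by (auto simp: ends_def base_tree_def)
qed

lemma special_tree:
  assumes G: "pverts G = V" "parcs G = E" "E \<noteq> {}"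
  shows "special_tree G"
proof -
  let ?T = base_tree
  \<comment> \<open>\<open>g\<close> and \<open>p\<close> find a vertex of \<open>Y\<close> or
    \<open>L\<close> from its neighbourhood, the label it carries in the construction.\<close>
  define g where "g = the_inv_into Y (\<lambda>y. E `` {y})"
  define p where "p x = the_inv_into L (\<lambda>l. E `` {l}) {x}" for x
  \<comment> \<open>The undefined case would be a pendant vertex at a subdividing vertex, which does
    not occur.\<close>
  define h where "h z = (case z of Inl (Inl x) \<Rightarrow> x | Inl (Inr e) \<Rightarrow> g e | Inr (Inl x) \<Rightarrow> p x | Inr (Inr e) \<Rightarrow> undefined)"
    for z :: "('a + 'a set) + ('a + 'a set)"
  have h_simps: "h (Inl (Inl x)) = x" "h (Inl (Inr e)) = g e" "h (Inr (Inl x)) = p x" for x e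
    by (simp_all add: h_def)
  have g: "g (E `` {y}) = y" if "y \<in> Y" for y
    using the_inv_into_f_f[OF Y_inj that] by (simp add: g_def)
  have p: "p x = l" if "l \<in> L" "E `` {l} = {x}" for x l
    using the_inv_into_f_f[OF L_inj that(1)] that(2) by (simp add: p_def)
  have gT: "g {a, b} \<in> Y" "E `` {g {a, b}} = {a, b}" if "(a, b) \<in> parcs ?T" for a b
    using base_arcE[OF that] g by metis+
  have pT: "p x \<in> L" "E `` {p x} = {x}" "(x, p x) \<in> E" if x: "x \<in> ends ?T" for x
  proof -
    obtain l where l: "l \<in> L" "(x, l) \<in> E" using x unfolding ends_base_tree by auto
    have "x \<in> E `` {l}" using l sym by auto
    then have "E `` {l} = {x}" using L_nb[OF l(1)] by (metis singletonD)
    then show "p x \<in> L" "E `` {p x} = {x}" "(x, p x) \<in> E" using p l by auto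
  qed
  note VT = special_of_eq(1)[OF base_tree_graph] and ET = special_of_eq(2)[OF base_tree_graph]
  have pv: "pverts ?T = X" by (simp add: base_tree_def)
  have imY: "g ` (\<lambda>(a, b). {a, b}) ` parcs ?T = Y"
  proof
    show "g ` (\<lambda>(a, b). {a, b}) ` parcs ?T \<subseteq> Y" using gT(1) by auto
    show "Y \<subseteq> g ` (\<lambda>(a, b). {a, b}) ` parcs ?T"
    proof
      fix y assume y: "y \<in> Y"
      then obtain a b where ab: "a \<noteq> b" "E `` {y} = {a, b}" using Y_nb by blast
      then have "(a, b) \<in> parcs ?T" using y by (auto simp: base_tree_def)
      moreover have "y = g {a, b}" using g[OF y] ab by simp
      ultimately show "y \<in> g ` (\<lambda>(a, b). {a, b}) ` parcs ?T" by force
    qed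
  qed
  have imL: "p ` ends ?T = L"
  proof
    show "p ` ends ?T \<subseteq> L" using pT by auto
    show "L \<subseteq> p ` ends ?T"
    proof
      fix l assume l: "l \<in> L"
      then obtain x where x: "E `` {l} = {x}" using L_nb by blast
      then have "(l, x) \<in> E" by auto
      then have "x \<in> X" "(x, l) \<in> E" using nonX_adj l sym by auto
      then have "x \<in> ends ?T" using l unfolding ends_base_tree by auto
      then show "l \<in> p ` ends ?T" using p[OF l x] by auto
    qed
  qed
  have vG: "pverts G = h ` pverts (special_of ?T)"
  proof -
    have "h ` pverts (special_of ?T) = X \<union> g ` (\<lambda>(a, b). {a, b}) ` parcs ?T \<union> p ` ends ?T"
      unfolding VT pv by (simp add: image_Un image_image case_prod_beta h_simps)
    then show ?thesis using imY imL G V_eq by simp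
  qed
  have inj: "inj_on h (pverts (special_of ?T))"
  proof (rule inj_onI)
    fix z z' assume z: "z \<in> pverts (special_of ?T)" "z' \<in> pverts (special_of ?T)" and eq: "h z = h z'"
    \<comment> \<open>The class of \<open>h z\<close> among the disjoint sets \<open>X\<close>,
      \<open>Y\<close>, \<open>L\<close> reveals the constructor of \<open>z\<close>, and its
      neighbourhood reveals the label.\<close>
    have cases: "(\<exists>x\<in>X. z = Inl (Inl x) \<and> h z = x) \<or> (\<exists>e. z = Inl (Inr e) \<and> h z \<in> Y \<and> E `` {h z} = e)
        \<or> (\<exists>x. z = Inr (Inl x) \<and> h z \<in> L \<and> E `` {h z} = {x})" if z: "z \<in> pverts (special_of ?T)" for z
    proof -
      consider x where "x \<in> X" "z = Inl (Inl x)" | a b where "(a, b) \<in> parcs ?T" "z = Inl (Inr {a, b})"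
        | x where "x \<in> ends ?T" "z = Inr (Inl x)"
        using z unfolding VT pv by auto
      then show ?thesis
      proof cases
        case 1
        then show ?thesis by (simp add: h_simps)
      next
        case 2
        then show ?thesis using gT[OF 2(1)] by (simp add: h_simps)
      next
        case 3
        then show ?thesis using pT[OF 3(1)] by (simp add: h_simps)
      qed
    qed
    show "z = z'"
      using cases[OF z(1), unfolded eq] cases[OF z(2)]
      by (elim disjE bexE exE conjE) (metis disj disjoint_iff singleton_inject)+
  qed
  have arcs: "parcs G = (\<lambda>(u, v). (h u, h v)) ` parcs (special_of ?T)"
  proof -
    have "(\<lambda>(u, v). (h u, h v)) ` parcs (special_of ?T) =
      (\<Union>(u, v)\<in>parcs ?T. {(u, g {u, v}), (g {u, v}, u)}) \<union> (\<Union>v\<in>ends ?T. {(v, p v), (p v, v)})"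
      unfolding ET by (simp add: image_Un image_UN case_prod_beta h_simps)
    also have "\<dots> = E"
    proof (intro equalityI subsetI)
      fix e assume "e \<in> (\<Union>(u, v)\<in>parcs ?T. {(u, g {u, v}), (g {u, v}, u)}) \<union> (\<Union>v\<in>ends ?T. {(v, p v), (p v, v)})"
      then consider u v where "(u, v) \<in> parcs ?T" "e = (u, g {u, v}) \<or> e = (g {u, v}, u)"
        | v where "v \<in> ends ?T" "e = (v, p v) \<or> e = (p v, v)" by auto
      then show "e \<in> E"
      proof cases
        case 1
        then have "(g {u, v}, u) \<in> E" using gT(2) by auto
        then show ?thesis using 1 sym by auto
      next
        case 2
        then show ?thesis using pT(3) sym by auto
      qed
    next
      \<comment> \<open>Only arcs starting in \<open>X\<close> are needed: the opposite arc is
        listed alongside, and the second half of a subdivided edge comes from the reversed arc of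
        the base tree.\<close>
      have half: "(x, t) \<in> (\<Union>(u, v)\<in>parcs ?T. {(u, g {u, v})}) \<union> (\<Union>v\<in>ends ?T. {(v, p v)})"
        if xt: "x \<in> X" "t \<in> Y \<union> L" "(x, t) \<in> E" for x t
      proof (cases "t \<in> Y")
        case True
        have tx: "x \<in> E `` {t}" using xt sym by auto
        obtain a b where ab: "a \<noteq> b" "E `` {t} = {a, b}" using Y_nb[OF True] by blast
        then obtain c where c: "E `` {t} = {x, c}" "x \<noteq> c" using tx by auto
        then have "(x, c) \<in> parcs ?T" using True by (auto simp: base_tree_def)
        moreover have "t = g {x, c}" using g[OF True] c by simp
        ultimately show ?thesis by blast
      next
        case False
        then have t: "t \<in> L" using xt by simp
        then have "x \<in> ends ?T" using xt unfolding ends_base_tree by auto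
        moreover have "x \<in> E `` {t}" using xt sym by auto
        then have "E `` {t} = {x}" using L_nb[OF t] by (metis singletonD)
        then have "t = p x" using p[OF t] by simp
        ultimately show ?thesis by blast
      qed
      fix e assume e: "e \<in> E"
      obtain u v where uv: "e = (u, v)" by (cases e)
      consider "u \<in> X" "v \<in> Y \<union> L" | "v \<in> X" "u \<in> Y \<union> L" using subsetD[OF edges e] uv by auto
      then show "e \<in> (\<Union>(u, v)\<in>parcs ?T. {(u, g {u, v}), (g {u, v}, u)}) \<union> (\<Union>v\<in>ends ?T. {(v, p v), (p v, v)})"
      proof cases
        case 1
        then show ?thesis using half[of u v] e uv by fastforce
      next
        case 2
        then show ?thesis using half[of v u] e uv sym by fastforce
      qed
    qed
    finally show ?thesis using G by simp
  qed
  have wf: "pair_wf_digraph (special_of ?T)"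
  proof -
    interpret S: special_structure "parcs (special_of ?T)" "pverts (special_of ?T)"
      "(\<lambda>v. Inl (Inl v)) ` pverts ?T" "(\<lambda>(u, v). Inl (Inr {u, v})) ` parcs ?T" "(\<lambda>v. Inr (Inl v)) ` ends ?T"
      by (rule special_of_structure[OF base_tree_tree[OF G(3)]])
    show ?thesis using S.EV by unfold_locales auto
  qed
  have "digraph_iso (with_proj (special_of ?T)) (with_proj G)"
    unfolding digraph_iso_iff[OF wf] using inj vG arcs by blast
  then show ?thesis using base_tree_tree[OF G(3)] unfolding special_tree_def by blast
qed

end

theorem theorem5:
  fixes G :: "'a pair_pre_digraph"
  assumes "pair_graph G" and "chordal G"
  shows "(special_tree G \<longleftrightarrow> strongly_critical G) \<and> (strongly_critical G \<longleftrightarrow> critical G)"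
proof -
  have "strongly_critical G" if "special_tree G"
    using special_tree_structure[OF that] special_structure_strongly_critical[OF assms(1)] by metis
  moreover have "special_tree G" if crit: "critical G"
  proof -
    obtain X Y L where "special_structure (parcs G) (pverts G) X Y L"
      using critical_chordal_special_structure[OF assms crit] by blast
    then show ?thesis
      using special_structure.special_tree[of "parcs G" "pverts G" X Y L G] crit
      by (simp add: critical_def)
  qed
  ultimately show ?thesis using strongly_critical_imp_critical by blast
qed

end
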